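(* Let $\mathbb{F}$ be a field of odd characteristic $p$, and let $q=p^n$, where $n>0$ is an integer. Assume that there are $\sigma,\rho\in\mathbb{F}$ with $\sigma\neq 0$ and $\rho^p-\sigma^{p-1}\rho-1=0$. Let $H=H(2;(1,n);\Phi(1))$ be the $pq$-dimensional Lie algebra over $\mathbb{F}$ described in the context, with $\bar x=x^{(p-1)}$ and $\bar y=y^{(q-1)}$. For $0\le j\le q-1$ and $\alpha\in(1-j)\rho+\mathbb{F}_p\sigma$ set $$e_{1-j,\alpha}=\sigma^{p-1}\,j\,\bar x\,y^{(j)}+\sum_{i=0}^{p-1}\alpha^i x^{(i)}y^{(j)}\in H ,$$ and put $X=e_{1,\rho+\sigma}$ and $Y=e_{2-q,2\rho+\sigma}$, that is, $$X=\sum_{i=0}^{p-1}(\rho+\sigma)^i x^{(i)}\qquad\text{and}\qquad Y=-\sigma^{p-1}\bar x\bar y+\sum_{i=0}^{p-1}(2\rho+\sigma)^i x^{(i)}\bar y .$$ Then: (1) $X$ and $Y$ generate $H$ as a Lie algebra, and a grading of $H$ over $\mathbb{Z}/(q-1)p\mathbb{Z}$ is determined by declaring $X$ and $Y$ to have degree one. (2) $X$ and $Y$ are part of a graded basis of $H$ given by the elements $e_{1-j,\alpha}$ (for $0\le j\le q-1$ and $\alpha\in(1-j)\rho+\mathbb{F}_p\sigma$). For $2-q\le r\le 1$ and $s\in\mathbb{Z}$, the degree $k$ modulo $(q-1)p$ of $e_{r,r\rho+s\sigma}$ is determined by $k\equiv r\pmod{q-1}$ and $k\equiv s\pmod p$.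 (3) The loop algebra $N$ of $H$ with respect to this grading is a thin Lie algebra with second diamond in degree $q$. (4) The diamonds of $N$ occur in all degrees congruent to $1$ modulo $q-1$ (and in no other degree), and the types of the diamonds after the first one, taken in order of increasing degree, follow an arithmetic progression (in $\mathbb{F}$) not contained in the prime field $\mathbb{F}_p$.
   Context: Conventions: iterated Lie brackets are left-normed, $[a,b,c]=[[a,b],c]$; $0^0=1$. The Lie algebra $H(2;(n_1,n_2);\Phi(1))$. Let $\mathbb{F}$ be a field of characteristic $p>0$ and $n_1,n_2$ positive integers. The divided power algebra $\mathcal{O}(2;(n_1,n_2))$ is the commutative associative $\mathbb{F}$-algebra with basis the monomials $x^{(i)}y^{(j)}$, $0\le i<p^{n_1}$, $0\le j<p^{n_2}$, and multiplication $x^{(i)}y^{(j)}\cdot x^{(k)}y^{(l)}=\binom{i+k}{i}\binom{j+l}{j}x^{(i+k)}y^{(j+l)}$, where the right-hand side is zero if $i+k\ge p^{n_1}$ or $j+l\ge p^{n_2}$. Here $x^{(0)}=y^{(0)}=1$, $x=x^{(1)}$, $y=y^{(1)}$, $\bar x=x^{(p^{n_1}-1)}$, $\bar y=y^{(p^{n_2}-1)}$. Let $\partial_1,\partial_2$ be the derivations with $\partial_1(x^{(i)}y^{(j)})=x^{(i-1)}y^{(j)}$ and $\partial_2(x^{(i)}y^{(j)})=x^{(i)}y^{(j-1)}$, where $x^{(-1)}=y^{(-1)}=0$. The Hamiltonian Lie algebra $H(2;(n_1,n_2);\Phi(1))$ is identified with the vector space $\mathcal{O}(2;(n_1,n_2))$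 with the Lie bracket $$\{f,g\}=\partial_2(f)\partial_1(g)-\partial_1(f)\partial_2(g)+\bar x\bigl(\partial_2(f)\,g-f\,\partial_2(g)\bigr).$$ In the statement, $(n_1,n_2)=(1,n)$. Loop algebra. Let $S=\bigoplus_{k\in\mathbb{Z}/M\mathbb{Z}}S_k$ be a finite-dimensional Lie algebra over $\mathbb{F}$ with a grading over $\mathbb{Z}/M\mathbb{Z}$, and let $t$ be an indeterminate. The loop algebra of $S$ with respect to the grading is the Lie subalgebra of $S\otimes\mathbb{F}[t]$ generated by $S_{\bar 1}\otimes t$. It is graded over the positive integers by the degree in $t$. Thin Lie algebras. A graded Lie algebra $L=\bigoplus_{i\ge1}L_i$ over $\mathbb{F}$ is thin if $\dim L_1=2$ and the covering property holds: $L_{i+1}=[u,L_1]$ for every $0\ne u\in L_i$ and all $i\ge1$. Thin Lie algebras are assumed to be infinite-dimensional. Every component then has dimension at most $2$; the components of dimension $2$ are called diamonds. $L_1$ is the first diamond, and one requires at least one further diamond; the second diamond is the one of next smallest degree. Diamond types. Let $L$ be a thin Lie algebra in odd characteristic $p$ with second diamond in degree $q$, a power of $p$. Types are assigned to the diamonds of degree greater than $1$, with respect to generators $X_L,Y_L$ spanning $L_1$ such that $[L_2,Y_L]=0$ (this condition is required only if $q>3$) and $[V,X_L,X_L]=0=[V,Y_L,Y_L]$, $[V,Y_L,X_L]=-2[V,X_L,Y_L]$ for $0\ne V\in L_{q-1}$. In the statement one takes $X_L=X\otimes t$, $Y_L=Y\otimes t$. A diamond $L_i$ with $i>1$, where $L_{i-1}=\mathbb{F}V$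 is one-dimensional, has (finite) type $\mu\in\mathbb{F}$ if $$[V,Y_L,Y_L]=0=[V,X_L,X_L],\qquad (1-\mu)[V,X_L,Y_L]=\mu[V,Y_L,X_L].$$ It has type $\infty$ if $[V,Y_L,Y_L]=0=[V,X_L,X_L]$ and $-[V,X_L,Y_L]=[V,Y_L,X_L]$. *)

theory Defs
  imports
    "HOL-Computational_Algebra.Polynomial"
    "HOL-Library.Function_Algebras"
    "HOL-Number_Theory.Cong"
begin

section \<open>Lie algebras and gradings\<close>

text \<open>
  A Lie algebra is carried by a subspace \<open>L\<close> of an ambient vector space; the bracket is only
  constrained on \<open>L\<close>.
\<close>

locale lie_algebra = vector_space scale
  for scale :: "'a::field \<Rightarrow> 'v::ab_group_add \<Rightarrow> 'v" +
  fixes L :: "'v set" and br :: "'v \<Rightarrow> 'v \<Rightarrow> 'v"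
  assumes subspace_L: "module.subspace scale L"
    and br_closed: "\<lbrakk>x \<in> L; y \<in> L\<rbrakk> \<Longrightarrow> br x y \<in> L"
    and br_add_left: "\<lbrakk>x \<in> L; y \<in> L; z \<in> L\<rbrakk> \<Longrightarrow> br (x + y) z = br x z + br y z"
    and br_add_right: "\<lbrakk>x \<in> L; y \<in> L; z \<in> L\<rbrakk> \<Longrightarrow> br x (y + z) = br x y + br x z"
    and br_scale_left: "\<lbrakk>x \<in> L; y \<in> L\<rbrakk> \<Longrightarrow> br (scale c x) y = scale c (br x y)"
    and br_scale_right: "\<lbrakk>x \<in> L; y \<in> L\<rbrakk> \<Longrightarrow> br x (scale c y) = scale c (br x y)"
    and br_self: "x \<in> L \<Longrightarrow> br x x = 0"
    and jacobi: "\<lbrakk>x \<in> L; y \<in> L; z \<in> L\<rbrakk> \<Longrightarrow>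
      br x (br y z) + br y (br z x) + br z (br x y) = 0"

definition lie_subalgebra ::
  "('a::field \<Rightarrow> 'v::ab_group_add \<Rightarrow> 'v) \<Rightarrow> 'v set \<Rightarrow> ('v \<Rightarrow> 'v \<Rightarrow> 'v) \<Rightarrow> 'v set \<Rightarrow> bool" where
  "lie_subalgebra scale L br K \<longleftrightarrow>
     module.subspace scale K \<and> K \<subseteq> L \<and> (\<forall>x\<in>K. \<forall>y\<in>K. br x y \<in> K)"

definition lie_generated ::
  "('a::field \<Rightarrow> 'v::ab_group_add \<Rightarrow> 'v) \<Rightarrow> 'v set \<Rightarrow> ('v \<Rightarrow> 'v \<Rightarrow> 'v) \<Rightarrow> 'v set \<Rightarrow> 'v set" where
  "lie_generated scale L br A = \<Inter>{K. lie_subalgebra scale L br K \<and> A \<subseteq> K}"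

text \<open>
  \<open>L\<close> is the direct sum of the \<open>V i\<close>, \<open>i \<in> I\<close>: the summation map from finitely supported
  families to \<open>L\<close> is bijective.
\<close>

definition is_direct_sum :: "'i set \<Rightarrow> ('i \<Rightarrow> 'v::ab_group_add set) \<Rightarrow> 'v set \<Rightarrow> bool" where
  "is_direct_sum I V L \<longleftrightarrow>
     bij_betw (\<lambda>f. \<Sum>i | f i \<noteq> 0. f i)
       {f. finite {i. f i \<noteq> 0} \<and> (\<forall>i\<in>I. f i \<in> V i) \<and> (\<forall>i. i \<notin> I \<longrightarrow> f i = 0)} L"

definition lie_grading ::
  "('a::field \<Rightarrow> 'v::ab_group_add \<Rightarrow> 'v) \<Rightarrow> 'v set \<Rightarrow> ('v \<Rightarrow> 'v \<Rightarrow> 'v) \<Rightarrow>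
     'i::plus set \<Rightarrow> ('i \<Rightarrow> 'v set) \<Rightarrow> bool" where
  "lie_grading scale L br I V \<longleftrightarrow>
     lie_algebra scale L br \<and>
     (\<forall>i\<in>I. module.subspace scale (V i)) \<and>
     is_direct_sum I V L \<and>
     (\<forall>i\<in>I. \<forall>j\<in>I. \<forall>x\<in>V i. \<forall>y\<in>V j. br x y \<in> V (i + j))"

text \<open>
  A grading over \<open>\<int>/M\<int>\<close> is an \<open>M\<close>-periodic family indexed by \<open>\<int>\<close>, one component for each
  residue class.
\<close>

definition cyclic_lie_grading ::
  "('a::field \<Rightarrow> 'v::ab_group_add \<Rightarrow> 'v) \<Rightarrow> 'v set \<Rightarrow> ('v \<Rightarrow> 'v \<Rightarrow> 'v) \<Rightarrow>
     nat \<Rightarrow> (int \<Rightarrow> 'v set) \<Rightarrow> bool" where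
  "cyclic_lie_grading scale L br M S \<longleftrightarrow>
     lie_grading scale L br {0..<int M} S \<and> (\<forall>k. S (k + int M) = S k)"

definition graded_basis ::
  "('a::field \<Rightarrow> 'v::ab_group_add \<Rightarrow> 'v) \<Rightarrow> 'v set \<Rightarrow> ('i \<Rightarrow> 'v set) \<Rightarrow>
     'j set \<Rightarrow> ('j \<Rightarrow> 'v) \<Rightarrow> bool" where
  "graded_basis scale L S J b \<longleftrightarrow>
     inj_on b J \<and> \<not> module.dependent scale (b ` J) \<and> module.span scale (b ` J) = L \<and>
     (\<forall>j\<in>J. \<exists>k. b j \<in> S k)"


section \<open>Loop algebras\<close>

text \<open>\<open>L \<otimes> F[t]\<close> is the space of polynomials in \<open>t\<close> with coefficients in \<open>L\<close>; \<open>u \<otimes> t^k\<close> is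
  \<open>monom u k\<close>.\<close>

definition loop_scale :: "('a \<Rightarrow> 'v::zero \<Rightarrow> 'v) \<Rightarrow> 'a \<Rightarrow> 'v poly \<Rightarrow> 'v poly" where
  "loop_scale scale c = map_poly (scale c)"

definition loop_bracket ::
  "('v::ab_group_add \<Rightarrow> 'v \<Rightarrow> 'v) \<Rightarrow> 'v poly \<Rightarrow> 'v poly \<Rightarrow> 'v poly" where
  "loop_bracket br f g =
     (\<Sum>i\<le>degree f. \<Sum>j\<le>degree g. monom (br (coeff f i) (coeff g j)) (i + j))"

definition poly_extension :: "'v::zero set \<Rightarrow> 'v poly set" where
  "poly_extension L = {f. \<forall>k. coeff f k \<in> L}"

definition loop_algebra ::
  "('a::field \<Rightarrow> 'v::ab_group_add \<Rightarrow> 'v) \<Rightarrow> 'v set \<Rightarrow> ('v \<Rightarrow> 'v \<Rightarrow> 'v) \<Rightarrow>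
     (int \<Rightarrow> 'v set) \<Rightarrow> 'v poly set" where
  "loop_algebra scale L br S =
     lie_generated (loop_scale scale) (poly_extension L) (loop_bracket br)
       ((\<lambda>u. monom u 1) ` S 1)"

definition loop_component :: "'v::zero poly set \<Rightarrow> nat \<Rightarrow> 'v poly set" where
  "loop_component N k = {f \<in> N. \<exists>u. f = monom u k}"


section \<open>Thin Lie algebras and diamonds\<close>

definition diamond_degrees ::
  "('a::field \<Rightarrow> 'v::ab_group_add \<Rightarrow> 'v) \<Rightarrow> (nat \<Rightarrow> 'v set) \<Rightarrow> nat set" where
  "diamond_degrees scale V = {i. i \<ge> 1 \<and> vector_space.dim scale (V i) = 2}"

text \<open>The covering property reads \<open>V (i + 1) = [u, V 1]\<close>; infinite dimension and the existence
  of a diamond besides \<open>V 1\<close> are part of the definition.\<close>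

definition thin_lie_algebra ::
  "('a::field \<Rightarrow> 'v::ab_group_add \<Rightarrow> 'v) \<Rightarrow> 'v set \<Rightarrow> ('v \<Rightarrow> 'v \<Rightarrow> 'v) \<Rightarrow>
     (nat \<Rightarrow> 'v set) \<Rightarrow> bool" where
  "thin_lie_algebra scale L br V \<longleftrightarrow>
     lie_grading scale L br {1..} V \<and>
     (\<nexists>B. finite B \<and> L \<subseteq> module.span scale B) \<and>
     vector_space.dim scale (V 1) = 2 \<and>
     (\<forall>i\<ge>1. \<forall>u\<in>V i. u \<noteq> 0 \<longrightarrow> V (i + 1) = br u ` V 1) \<and>
     (\<exists>i>1. i \<in> diamond_degrees scale V)"

definition second_diamond_degree ::
  "('a::field \<Rightarrow> 'v::ab_group_add \<Rightarrow> 'v) \<Rightarrow> (nat \<Rightarrow> 'v set) \<Rightarrow> nat \<Rightarrow> bool" where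
  "second_diamond_degree scale V d \<longleftrightarrow>
     d > 1 \<and> d \<in> diamond_degrees scale V \<and> (\<forall>i\<in>diamond_degrees scale V. i > 1 \<longrightarrow> d \<le> i)"

text \<open>The normalization of the generators with respect to which diamond types are assigned,
  when the second diamond has degree \<open>q\<close>.\<close>

definition type_generators ::
  "('a::field \<Rightarrow> 'v::ab_group_add \<Rightarrow> 'v) \<Rightarrow> ('v \<Rightarrow> 'v \<Rightarrow> 'v) \<Rightarrow> (nat \<Rightarrow> 'v set) \<Rightarrow>
     nat \<Rightarrow> 'v \<Rightarrow> 'v \<Rightarrow> bool" where
  "type_generators scale br V q X Y \<longleftrightarrow>
     module.span scale {X, Y} = V 1 \<and>
     (q > 3 \<longrightarrow> (\<forall>u\<in>V 2. br u Y = 0)) \<and>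
     (\<forall>v\<in>V (q - 1). v \<noteq> 0 \<longrightarrow>
        br (br v X) X = 0 \<and> br (br v Y) Y = 0 \<and>
        br (br v Y) X = scale (- 2) (br (br v X) Y))"

definition has_finite_type ::
  "('a::field \<Rightarrow> 'v::ab_group_add \<Rightarrow> 'v) \<Rightarrow> ('v \<Rightarrow> 'v \<Rightarrow> 'v) \<Rightarrow> (nat \<Rightarrow> 'v set) \<Rightarrow>
     'v \<Rightarrow> 'v \<Rightarrow> nat \<Rightarrow> 'a \<Rightarrow> bool" where
  "has_finite_type scale br V X Y i \<mu> \<longleftrightarrow>
     i > 1 \<and> i \<in> diamond_degrees scale V \<and> vector_space.dim scale (V (i - 1)) = 1 \<and>
     (\<forall>v\<in>V (i - 1). v \<noteq> 0 \<longrightarrow>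
        br (br v Y) Y = 0 \<and> br (br v X) X = 0 \<and>
        scale (1 - \<mu>) (br (br v X) Y) = scale \<mu> (br (br v Y) X))"


section \<open>The Hamiltonian algebra \<open>H(2;(n\<^sub>1,n\<^sub>2);\<Phi>(1))\<close>\<close>

text \<open>An element of \<open>O(2;(n\<^sub>1,n\<^sub>2))\<close> is represented by its coefficient function: \<open>f i j\<close> is
  the coefficient of \<open>x\<^sup>(\<^sup>i\<^sup>) y\<^sup>(\<^sup>j\<^sup>)\<close>. The characteristic is that of the field.\<close>

type_synonym 'a dp = "nat \<Rightarrow> nat \<Rightarrow> 'a"

definition dp_space :: "nat \<Rightarrow> nat \<Rightarrow> 'a::field dp set" where
  "dp_space n1 n2 = {f. \<forall>i j. i \<ge> CHAR('a) ^ n1 \<or> j \<ge> CHAR('a) ^ n2 \<longrightarrow> f i j = 0}"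

definition dp_scale :: "'a::field \<Rightarrow> 'a dp \<Rightarrow> 'a dp" where
  "dp_scale c f = (\<lambda>i j. c * f i j)"

definition dp_monom :: "nat \<Rightarrow> nat \<Rightarrow> 'a::field dp" where
  "dp_monom k l = (\<lambda>i j. if i = k \<and> j = l then 1 else 0)"

definition dp_mult :: "nat \<Rightarrow> nat \<Rightarrow> 'a::field dp \<Rightarrow> 'a dp \<Rightarrow> 'a dp" where
  "dp_mult n1 n2 f g = (\<lambda>i j.
     if i < CHAR('a) ^ n1 \<and> j < CHAR('a) ^ n2
     then \<Sum>k\<le>i. \<Sum>l\<le>j. of_nat (i choose k) * of_nat (j choose l) * f k l * g (i - k) (j - l)
     else 0)"

definition dp_d1 :: "'a::field dp \<Rightarrow> 'a dp" where
  "dp_d1 f = (\<lambda>i j. f (i + 1) j)"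

definition dp_d2 :: "'a::field dp \<Rightarrow> 'a dp" where
  "dp_d2 f = (\<lambda>i j. f i (j + 1))"

definition ham_bracket :: "nat \<Rightarrow> nat \<Rightarrow> 'a::field dp \<Rightarrow> 'a dp \<Rightarrow> 'a dp" where
  "ham_bracket n1 n2 f g =
     dp_mult n1 n2 (dp_d2 f) (dp_d1 g) - dp_mult n1 n2 (dp_d1 f) (dp_d2 g) +
     dp_mult n1 n2 (dp_monom (CHAR('a) ^ n1 - 1) 0)
       (dp_mult n1 n2 (dp_d2 f) g - dp_mult n1 n2 f (dp_d2 g))"

text \<open>The prime field \<open>F\<^sub>p\<close> inside a field of characteristic \<open>p > 0\<close>.\<close>

definition prime_subfield :: "'a::field set" where
  "prime_subfield = range of_int"

text \<open>\<open>e\<^bsub>r,\<alpha>\<^esub>\<close> for \<open>r = 1 - j\<close>, \<open>j \<ge> 0\<close>.\<close>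

definition ham_e :: "'a::field \<Rightarrow> int \<Rightarrow> 'a \<Rightarrow> 'a dp" where
  "ham_e \<sigma> r \<alpha> = (let j = nat (1 - r) in
     dp_scale (\<sigma> ^ (CHAR('a) - 1) * of_nat j) (dp_monom (CHAR('a) - 1) j) +
     (\<Sum>i = 0..CHAR('a) - 1. dp_scale (\<alpha> ^ i) (dp_monom i j)))"

definition ham_index :: "nat \<Rightarrow> 'a::field \<Rightarrow> 'a \<Rightarrow> (int \<times> 'a) set" where
  "ham_index q \<sigma> \<rho> =
     {(1 - int j, of_int (1 - int j) * \<rho> + c * \<sigma>) | j c. j \<le> q - 1 \<and> c \<in> prime_subfield}"

end

theory Submission
  imports Defs
begin

text \<open>
  Write \<open>\<phi>\<^sub>\<alpha> = \<Sum>\<^sub>i \<alpha>\<^sup>i x\<^sup>(\<^sup>i\<^sup>)\<close> for the truncated exponential. It satisfies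
  \<open>\<phi>\<^sub>\<alpha> \<phi>\<^sub>\<beta> = \<phi>\<^bsub>\<alpha> + \<beta>\<^esub>\<close> and fails to be an eigenvector of \<open>\<partial>\<^sub>1\<close> only by the term \<open>- \<alpha>\<^sup>p x\<^sup>(\<^sup>p\<^sup>-\<^sup>1\<^sup>)\<close>. The
  hypothesis on \<open>\<rho>\<close> says precisely that \<open>\<alpha>\<^sup>p = \<sigma>\<^sup>p\<^sup>-\<^sup>1 \<alpha> + (1 - j)\<close> for every \<open>\<alpha> \<in> (1 - j) \<rho> + F\<^sub>p \<sigma>\<close>
  (lemma \<open>root_power\<close>); with it the correction term in \<open>e\<close> absorbs all the defects, and the bracket of
  \<open>e\<^bsub>1-j,\<alpha>\<^esub>\<close> and \<open>e\<^bsub>1-l,\<beta>\<^esub>\<close> becomes a scalar multiple of \<open>e\<^bsub>2-j-l,\<alpha>+\<beta>\<^esub>\<close>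
  (lemma \<open>ham_bracket_ham_e\<close>). So these elements behave like root vectors, and everything else is read off
  this multiplication table.

  They form a basis: for fixed \<open>j\<close> the coordinate functionals are given by the Lagrange polynomials
  \<open>1 - ((x - \<alpha>) / \<sigma>)\<^sup>p\<^sup>-\<^sup>1\<close> of the coset \<open>(1 - j) \<rho> + F\<^sub>p \<sigma>\<close>, and their number is the dimension. The label
  \<open>(1 - j, s)\<close> of \<open>e\<^bsub>1-j,(1-j)\<rho>+s\<sigma>\<^esub>\<close> is additive under the bracket, hence by the Chinese remainder theorem
  it gives a grading modulo \<open>(q - 1) p\<close>. A component has dimension one, except in the degrees congruent to
  \<open>1\<close> modulo \<open>q - 1\<close>, where \<open>j = 0\<close> and \<open>j = q - 1\<close> both occur.

  Bracketing with \<open>X\<close> and \<open>Y\<close> moves along the table by scalars of the shape \<open>r \<rho> + s \<sigma>\<close> with \<open>r = \<plusminus>1, 2\<close>.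
  These never vanish, since \<open>\<alpha> = r \<rho> + s \<sigma> = 0\<close> would force \<open>r = 0\<close> in the displayed equation for \<open>\<alpha>\<^sup>p\<close>.
  This is the covering property (lemma \<open>component_covering\<close>). The covering property in turn propagates any
  inclusion from degree one to all positive degrees (lemma \<open>S_ascend\<close>); applied to a subalgebra containing
  \<open>X\<close> and \<open>Y\<close>, to a second grading, and to the loop algebra, it yields generation, uniqueness of
  the grading, and the description of the loop algebra as \<open>\<Oplus>\<^bsub>k\<ge>1\<^esub> S\<^sub>k \<otimes> t\<^sup>k\<close>.

  The two brackets \<open>[V, X, Y]\<close> and \<open>[V, Y, X]\<close> below a diamond are likewise found in the table: for the diamond
  in degree \<open>1 + (m + 1) (q - 1)\<close> they are in the ratio \<open>- (\<rho> - m \<sigma>) : 2 \<rho> - m \<sigma>\<close>, which means type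
  \<open>- 1 + m \<sigma> / \<rho>\<close>. The increment \<open>\<sigma> / \<rho>\<close> is not in the prime field, again because
  \<open>r \<rho> + s \<sigma> \<noteq> 0\<close> when \<open>r \<noteq> 0\<close>.
\<close>

section \<open>The divided power algebra\<close>

text \<open>
  The product of divided power series without truncation. On it the shifts \<open>dp_d1\<close> and
  \<open>dp_d2\<close> are derivations with no condition on the arguments, which makes its algebraic laws easy to prove.
\<close>

definition hurwitz_prod :: "'a::field dp \<Rightarrow> 'a dp \<Rightarrow> 'a dp" where
  "hurwitz_prod f g = (\<lambda>i j. \<Sum>k\<le>i. \<Sum>l\<le>j.
     of_nat (i choose k) * of_nat (j choose l) * f k l * g (i - k) (j - l))"

lemma binomial_convolution_Suc:
  fixes F :: "nat \<Rightarrow> nat \<Rightarrow> 'a::comm_ring_1"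
  shows "(\<Sum>k\<le>Suc i. of_nat (Suc i choose k) * F k (Suc i - k)) =
    (\<Sum>k\<le>i. of_nat (i choose k) * F (Suc k) (i - k)) +
    (\<Sum>k\<le>i. of_nat (i choose k) * F k (Suc (i - k)))"
proof -
  have 1: "(\<Sum>k\<le>Suc i. of_nat (Suc i choose k) * F k (Suc i - k)) =
    F 0 (Suc i) + (\<Sum>k\<le>i. of_nat (i choose k) * F (Suc k) (i - k)) +
     (\<Sum>k\<le>i. of_nat (i choose Suc k) * F (Suc k) (i - k))"
    by (subst sum.atMost_Suc_shift) (simp add: algebra_simps sum.distrib)
  have "F 0 (Suc i) + (\<Sum>k\<le>i. of_nat (i choose Suc k) * F (Suc k) (i - k)) =
      (\<Sum>k\<le>Suc i. of_nat (i choose k) * F k (Suc i - k))"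
    by (subst sum.atMost_Suc_shift) simp
  also have "\<dots> = (\<Sum>k\<le>i. of_nat (i choose k) * F k (Suc (i - k)))"
    by (simp add: Suc_diff_le binomial_eq_0)
  finally show ?thesis unfolding 1 by (simp add: algebra_simps)
qed

lemma dp_d1_hurwitz_prod:
  "dp_d1 (hurwitz_prod f g) = hurwitz_prod (dp_d1 f) g + hurwitz_prod f (dp_d1 g)"
proof (intro ext)
  fix i j
  let ?F = "\<lambda>a b. \<Sum>l\<le>j. of_nat (j choose l) * f a l * g b (j - l)"
  show "dp_d1 (hurwitz_prod f g) i j =
    (hurwitz_prod (dp_d1 f) g + hurwitz_prod f (dp_d1 g)) i j"
    using binomial_convolution_Suc[of i ?F]
    by (simp add: dp_d1_def hurwitz_prod_def sum_distrib_left mult.assoc del: sum.atMost_Suc binomial_Suc_Suc)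
qed

lemma dp_d2_hurwitz_prod:
  "dp_d2 (hurwitz_prod f g) = hurwitz_prod (dp_d2 f) g + hurwitz_prod f (dp_d2 g)"
proof (intro ext)
  fix i j
  have "(\<Sum>l\<le>Suc j. of_nat (i choose k) * of_nat (Suc j choose l) * f k l * g (i - k) (Suc j - l)) =
    (\<Sum>l\<le>j. of_nat (i choose k) * of_nat (j choose l) * f k (Suc l) * g (i - k) (j - l)) +
    (\<Sum>l\<le>j. of_nat (i choose k) * of_nat (j choose l) * f k l * g (i - k) (Suc (j - l)))" for k
    using binomial_convolution_Suc[of j "\<lambda>a b. of_nat (i choose k) * f k a * g (i - k) b"]
    by (simp add: mult.assoc mult.left_commute del: sum.atMost_Suc binomial_Suc_Suc)
  then show "dp_d2 (hurwitz_prod f g) i j =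
    (hurwitz_prod (dp_d2 f) g + hurwitz_prod f (dp_d2 g)) i j"
    by (simp add: dp_d2_def hurwitz_prod_def sum.distrib del: sum.atMost_Suc binomial_Suc_Suc)
qed

lemma hurwitz_prod_add_left: "hurwitz_prod (f + g) h = hurwitz_prod f h + hurwitz_prod g h"
  by (intro ext) (simp add: hurwitz_prod_def algebra_simps sum.distrib)

lemma hurwitz_prod_add_right: "hurwitz_prod f (g + h) = hurwitz_prod f g + hurwitz_prod f h"
  by (intro ext) (simp add: hurwitz_prod_def algebra_simps sum.distrib)

lemma hurwitz_prod_Suc1:
  "hurwitz_prod f g (Suc i) j = hurwitz_prod (dp_d1 f) g i j + hurwitz_prod f (dp_d1 g) i j"
  using fun_cong[OF fun_cong[OF dp_d1_hurwitz_prod[of f g], of i], of j] by (simp add: dp_d1_def)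

lemma hurwitz_prod_Suc2:
  "hurwitz_prod f g i (Suc j) = hurwitz_prod (dp_d2 f) g i j + hurwitz_prod f (dp_d2 g) i j"
  using fun_cong[OF fun_cong[OF dp_d2_hurwitz_prod[of f g], of i], of j] by (simp add: dp_d2_def)

text \<open>
  A series is determined by its constant term together with its images under the two shifts. As the shifts
  are derivations, commutativity reduces by induction on the indices to the constant term; the same applies to
  associativity below.
\<close>

lemma hurwitz_prod_commute:
  fixes f g :: "'a::field dp"
  shows "hurwitz_prod f g = hurwitz_prod g f"
proof -
  have base: "hurwitz_prod f g 0 j = hurwitz_prod g f 0 j" for f g :: "'a dp" and j
  proof (induction j arbitrary: f g)
    case 0
    show ?case by (simp add: hurwitz_prod_def)
  next
    case (Suc j)
    show ?case
      unfolding hurwitz_prod_Suc2 using Suc.IH[of "dp_d2 f" g] Suc.IH[of f "dp_d2 g"] by simp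
  qed
  have "hurwitz_prod f g i j = hurwitz_prod g f i j" for i j
  proof (induction i arbitrary: f g)
    case 0
    show ?case by (rule base)
  next
    case (Suc i)
    show ?case
      unfolding hurwitz_prod_Suc1 using Suc.IH[of "dp_d1 f" g] Suc.IH[of f "dp_d1 g"] by simp
  qed
  then show ?thesis by blast
qed

lemma hurwitz_prod_assoc:
  fixes f g h :: "'a::field dp"
  shows "hurwitz_prod (hurwitz_prod f g) h = hurwitz_prod f (hurwitz_prod g h)"
proof -
  have base: "hurwitz_prod (hurwitz_prod f g) h 0 j = hurwitz_prod f (hurwitz_prod g h) 0 j"
    for f g h :: "'a dp" and j
  proof (induction j arbitrary: f g h)
    case 0
    show ?case by (simp add: hurwitz_prod_def)
  next
    case (Suc j)
    show ?case
      by (simp add: hurwitz_prod_Suc2 dp_d2_hurwitz_prod hurwitz_prod_add_left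
          hurwitz_prod_add_right Suc.IH)
  qed
  have "hurwitz_prod (hurwitz_prod f g) h i j = hurwitz_prod f (hurwitz_prod g h) i j" for i j
  proof (induction i arbitrary: f g h)
    case 0
    show ?case by (rule base)
  next
    case (Suc i)
    show ?case
      by (simp add: hurwitz_prod_Suc1 dp_d1_hurwitz_prod hurwitz_prod_add_left
          hurwitz_prod_add_right Suc.IH)
  qed
  then show ?thesis by blast
qed

lemma dp_mult_apply:
  "dp_mult n1 n2 f g i j =
     (if i < CHAR('a) ^ n1 \<and> j < CHAR('a) ^ n2 then hurwitz_prod f g i j else 0)"
  for f g :: "'a::field dp"
  by (auto simp: dp_mult_def hurwitz_prod_def)

lemma hurwitz_prod_cong:
  assumes "\<And>k l. k \<le> i \<Longrightarrow> l \<le> j \<Longrightarrow> f k l = f' k l"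
    and "\<And>k l. k \<le> i \<Longrightarrow> l \<le> j \<Longrightarrow> g k l = g' k l"
  shows "hurwitz_prod f g i j = hurwitz_prod f' g' i j"
  unfolding hurwitz_prod_def using assms by (intro sum.cong refl) auto

lemma dp_mult_commute: "dp_mult n1 n2 f g = dp_mult n1 n2 g f"
  by (simp add: fun_eq_iff dp_mult_apply hurwitz_prod_commute[of f g])

lemma dp_mult_assoc:
  fixes f g h :: "'a::field dp"
  shows "dp_mult n1 n2 (dp_mult n1 n2 f g) h = dp_mult n1 n2 f (dp_mult n1 n2 g h)"
proof (intro ext)
  fix i j
  show "dp_mult n1 n2 (dp_mult n1 n2 f g) h i j = dp_mult n1 n2 f (dp_mult n1 n2 g h) i j"
  proof (cases "i < CHAR('a) ^ n1 \<and> j < CHAR('a) ^ n2")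
    case True
    have "hurwitz_prod (dp_mult n1 n2 f g) h i j = hurwitz_prod (hurwitz_prod f g) h i j"
      using True by (intro hurwitz_prod_cong) (auto simp: dp_mult_apply)
    moreover have "hurwitz_prod f (dp_mult n1 n2 g h) i j = hurwitz_prod f (hurwitz_prod g h) i j"
      using True by (intro hurwitz_prod_cong) (auto simp: dp_mult_apply)
    ultimately show ?thesis
      using True by (simp add: dp_mult_apply[of _ _ _ h] dp_mult_apply[of _ _ f] hurwitz_prod_assoc)
  qed (auto simp: dp_mult_apply)
qed

lemma dp_mult_left_commute:
  "dp_mult n1 n2 f (dp_mult n1 n2 g h) = dp_mult n1 n2 g (dp_mult n1 n2 f h)"
  by (metis dp_mult_assoc dp_mult_commute)

lemma dp_mult_add_right: "dp_mult n1 n2 f (g + h) = dp_mult n1 n2 f g + dp_mult n1 n2 f h"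
  by (intro ext) (simp add: dp_mult_apply hurwitz_prod_add_right)

lemma dp_mult_scale_right: "dp_mult n1 n2 f (dp_scale c g) = dp_scale c (dp_mult n1 n2 f g)"
  by (intro ext) (simp add: dp_mult_def dp_scale_def sum_distrib_left mult.left_commute)

lemma dp_mult_uminus_right: "dp_mult n1 n2 f (- g) = - dp_mult n1 n2 f g"
  by (intro ext) (simp add: dp_mult_def sum_negf)

lemma dp_mult_diff_right: "dp_mult n1 n2 f (g - h) = dp_mult n1 n2 f g - dp_mult n1 n2 f h"
  using dp_mult_add_right[of n1 n2 f g "- h"] by (simp add: dp_mult_uminus_right)

lemma dp_mult_add_left: "dp_mult n1 n2 (f + g) h = dp_mult n1 n2 f h + dp_mult n1 n2 g h"
  by (simp add: dp_mult_commute[of _ _ _ h] dp_mult_add_right)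

lemma dp_mult_scale_left: "dp_mult n1 n2 (dp_scale c f) g = dp_scale c (dp_mult n1 n2 f g)"
  by (simp add: dp_mult_commute[of _ _ _ g] dp_mult_scale_right)

lemma dp_mult_zero_right [simp]: "dp_mult n1 n2 f 0 = 0"
  by (intro ext) (simp add: dp_mult_def)

text \<open>
  From \<open>k (p\<^sup>N choose k) = p\<^sup>N (p\<^sup>N - 1 choose k - 1)\<close>: were the binomial coefficient prime to \<open>p\<close>, then
  \<open>p\<^sup>N\<close> would divide \<open>k\<close>.
\<close>

lemma of_nat_choose_prime_power_eq_0:
  assumes "prime CHAR('a::comm_ring_1)" "0 < k" "k < CHAR('a) ^ N"
  shows "of_nat (CHAR('a) ^ N choose k) = (0 :: 'a)"
proof -
  let ?q = "CHAR('a) ^ N"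
  have "?q dvd k * (?q choose k)"
    using times_binomial_minus1_eq[of k ?q] assms(2) by simp
  moreover have "\<not> ?q dvd k"
    using assms(2,3) by (auto dest: dvd_imp_le)
  ultimately have "\<not> coprime ?q (?q choose k)"
    by (meson coprime_dvd_mult_left_iff)
  then have "CHAR('a) dvd (?q choose k)"
    using assms(1) by (meson coprime_power_left_iff prime_imp_coprime)
  then show ?thesis by (simp add: of_nat_eq_0_iff_char_dvd)
qed

lemma dp_mult_in_dp_space: "dp_mult n1 n2 f g \<in> dp_space n1 n2"
  by (auto simp: dp_mult_def dp_space_def)

lemma dp_d1_in_dp_space: "f \<in> dp_space n1 n2 \<Longrightarrow> dp_d1 f \<in> dp_space n1 n2"
  by (auto simp: dp_d1_def dp_space_def)

lemma dp_d2_in_dp_space: "f \<in> dp_space n1 n2 \<Longrightarrow> dp_d2 f \<in> dp_space n1 n2"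
  by (auto simp: dp_d2_def dp_space_def)

text \<open>
  Truncation is compatible with the derivations because the first coefficient it cuts off vanishes already in
  the untruncated product: all inner binomial coefficients are \<open>0\<close> in characteristic \<open>p\<close>, and the two
  outer terms involve a coefficient outside the support.
\<close>

lemma hurwitz_prod_eq_0_at_boundary:
  fixes f g :: "'a::field dp"
  assumes "prime CHAR('a)" "f \<in> dp_space n1 n2" "g \<in> dp_space n1 n2"
  shows "hurwitz_prod f g (CHAR('a) ^ n1) j = 0" "hurwitz_prod f g i (CHAR('a) ^ n2) = 0"
proof -
  let ?p = "CHAR('a)"
  have "of_nat (?p ^ n1 choose k) * f k l * g (?p ^ n1 - k) m = 0" if "k \<le> ?p ^ n1" for k l m
    using that assms of_nat_choose_prime_power_eq_0[of k n1, where 'a='a]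
    by (cases "k = 0 \<or> k = ?p ^ n1") (auto simp: dp_space_def)
  then have "of_nat (?p ^ n1 choose k) * of_nat b * f k l * g (?p ^ n1 - k) m = 0"
    if "k \<le> ?p ^ n1" for k b l m using that by fastforce
  then show "hurwitz_prod f g (CHAR('a) ^ n1) j = 0"
    unfolding hurwitz_prod_def by (intro sum.neutral ballI) simp
  have "of_nat (?p ^ n2 choose k) * f l k * g m (?p ^ n2 - k) = 0" if "k \<le> ?p ^ n2" for k l m
    using that assms of_nat_choose_prime_power_eq_0[of k n2, where 'a='a]
    by (cases "k = 0 \<or> k = ?p ^ n2") (auto simp: dp_space_def)
  then have "of_nat b * of_nat (?p ^ n2 choose k) * f l k * g m (?p ^ n2 - k) = 0"
    if "k \<le> ?p ^ n2" for k b l m using that by fastforce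
  then show "hurwitz_prod f g i (CHAR('a) ^ n2) = 0"
    unfolding hurwitz_prod_def by (intro sum.neutral ballI) simp
qed

lemma dp_d1_mult:
  fixes f g :: "'a::field dp"
  assumes "prime CHAR('a)" "f \<in> dp_space n1 n2" "g \<in> dp_space n1 n2"
  shows "dp_d1 (dp_mult n1 n2 f g) = dp_mult n1 n2 (dp_d1 f) g + dp_mult n1 n2 f (dp_d1 g)"
proof (intro ext)
  fix i j
  have "hurwitz_prod (dp_d1 f) g i j + hurwitz_prod f (dp_d1 g) i j = 0" if "Suc i = CHAR('a) ^ n1"
    using hurwitz_prod_eq_0_at_boundary(1)[OF assms, of j] that hurwitz_prod_Suc1[of f g i j] by simp
  then show "dp_d1 (dp_mult n1 n2 f g) i j =
    (dp_mult n1 n2 (dp_d1 f) g + dp_mult n1 n2 f (dp_d1 g)) i j"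
    by (cases "Suc i = CHAR('a) ^ n1")
      (auto simp: dp_mult_apply dp_d1_def[of "dp_mult n1 n2 f g"] hurwitz_prod_Suc1)
qed

lemma dp_d2_mult:
  fixes f g :: "'a::field dp"
  assumes "prime CHAR('a)" "f \<in> dp_space n1 n2" "g \<in> dp_space n1 n2"
  shows "dp_d2 (dp_mult n1 n2 f g) = dp_mult n1 n2 (dp_d2 f) g + dp_mult n1 n2 f (dp_d2 g)"
proof (intro ext)
  fix i j
  have "hurwitz_prod (dp_d2 f) g i j + hurwitz_prod f (dp_d2 g) i j = 0" if "Suc j = CHAR('a) ^ n2"
    using hurwitz_prod_eq_0_at_boundary(2)[OF assms, of i] that hurwitz_prod_Suc2[of f g i j] by simp
  then show "dp_d2 (dp_mult n1 n2 f g) i j =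
    (dp_mult n1 n2 (dp_d2 f) g + dp_mult n1 n2 f (dp_d2 g)) i j"
    by (cases "Suc j = CHAR('a) ^ n2")
      (auto simp: dp_mult_apply dp_d2_def[of "dp_mult n1 n2 f g"] hurwitz_prod_Suc2)
qed

section \<open>The Hamiltonian Lie algebra\<close>

lemma vector_space_dp_scale: "vector_space (dp_scale :: 'a::field \<Rightarrow> 'a dp \<Rightarrow> 'a dp)"
  by standard (auto simp: dp_scale_def algebra_simps fun_eq_iff)

interpretation dp: vector_space dp_scale
  by (rule vector_space_dp_scale)

lemma subspace_dp_space: "dp.subspace (dp_space n1 n2)"
  by (auto simp: dp.subspace_def dp_space_def dp_scale_def)

lemma dp_d1_add: "dp_d1 (f + g) = dp_d1 f + dp_d1 g"
  and dp_d1_diff: "dp_d1 (f - g) = dp_d1 f - dp_d1 g"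
  and dp_d1_scale: "dp_d1 (dp_scale c f) = dp_scale c (dp_d1 f)"
  and dp_d2_add: "dp_d2 (f + g) = dp_d2 f + dp_d2 g"
  and dp_d2_diff: "dp_d2 (f - g) = dp_d2 f - dp_d2 g"
  and dp_d2_scale: "dp_d2 (dp_scale c f) = dp_scale c (dp_d2 f)"
  by (auto simp: dp_d1_def dp_d2_def dp_scale_def fun_eq_iff)

lemma dp_d2_d1: "dp_d2 (dp_d1 f) = dp_d1 (dp_d2 f)"
  by (simp add: dp_d1_def dp_d2_def)

text \<open>
  Let \<open>z\<close> be the top power of \<open>x\<close> and \<open>E f = \<partial>\<^sub>1 f + z f\<close>. The bracket is the determinant
  \<open>\<partial>\<^sub>2 f \<cdot> E g - E f \<cdot> \<partial>\<^sub>2 g\<close>. Because \<open>\<partial>\<^sub>2\<close> kills \<open>z\<close>, it commutes with \<open>E\<close>, and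
  \<open>E (f g) = E f \<cdot> g + f \<cdot> E g - z f g\<close>. These rules alone make the Jacobi sum cancel term by term.
\<close>

lemma lie_algebra_ham_bracket:
  assumes "prime CHAR('a::field)"
  shows "lie_algebra dp_scale (dp_space n1 n2 :: 'a dp set) (ham_bracket n1 n2)"
proof -
  let ?H = "dp_space n1 n2 :: 'a dp set" and ?m = "dp_mult n1 n2 :: 'a dp \<Rightarrow> _"
  let ?x = "dp_monom (CHAR('a) ^ n1 - 1) 0 :: 'a dp"
  define E where "E f = dp_d1 f + ?m ?x f" for f
  have x: "?x \<in> ?H" "dp_d2 ?x = 0"
    using assms by (auto simp: dp_space_def dp_monom_def dp_d2_def prime_gt_0_nat fun_eq_iff not_le)
  note diff = dp.subspace_diff[OF subspace_dp_space] and add = dp.subspace_add[OF subspace_dp_space]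
  have E_H: "E f \<in> ?H" if "f \<in> ?H" for f
    unfolding E_def by (intro add dp_d1_in_dp_space dp_mult_in_dp_space that)
  have br: "ham_bracket n1 n2 f g = ?m (dp_d2 f) (E g) - ?m (E f) (dp_d2 g)" for f g
    by (simp add: ham_bracket_def E_def dp_mult_add_right dp_mult_diff_right dp_mult_add_left
        dp_mult_assoc dp_mult_left_commute)
  have E_add: "E (f + g) = E f + E g" and E_diff: "E (f - g) = E f - E g"
    and E_scale: "E (dp_scale c f) = dp_scale c (E f)" for f g c
    by (simp_all add: E_def dp_d1_add dp_mult_add_right dp_d1_diff dp_mult_diff_right dp_d1_scale
        dp_mult_scale_right dp.scale_right_distrib)
  have E_mult: "E (?m f g) = ?m (E f) g + ?m f (E g) - ?m ?x (?m f g)"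
    if "f \<in> ?H" "g \<in> ?H" for f g
    using that by (simp add: E_def dp_d1_mult[OF assms] dp_mult_add_left dp_mult_add_right
        dp_mult_assoc dp_mult_left_commute)
  have DE: "dp_d2 (E f) = E (dp_d2 f)" if "f \<in> ?H" for f
    using that x by (simp add: E_def dp_d2_add dp_d2_d1 dp_d2_mult[OF assms] dp_mult_commute[of _ _ 0])
  have br_H: "ham_bracket n1 n2 f g \<in> ?H" for f g
    unfolding br by (intro diff dp_mult_in_dp_space)
  show ?thesis
  proof
    show "dp.subspace ?H" by (rule subspace_dp_space)
    show "ham_bracket n1 n2 f g \<in> ?H" for f g by (rule br_H)
    show "ham_bracket n1 n2 f f = 0" for f :: "'a dp"
      by (simp add: br dp_mult_commute)
    show "ham_bracket n1 n2 f (ham_bracket n1 n2 g h) + ham_bracket n1 n2 g (ham_bracket n1 n2 h f)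
        + ham_bracket n1 n2 h (ham_bracket n1 n2 f g) = 0"
      if "f \<in> ?H" "g \<in> ?H" "h \<in> ?H" for f g h
      using that
      by (simp add: br dp_d2_diff E_diff E_mult dp_d2_mult[OF assms] E_H dp_d2_in_dp_space DE
          dp_mult_diff_right dp_mult_add_right dp_mult_assoc dp_mult_commute dp_mult_left_commute)
  qed (simp_all add: br E_add E_scale dp_d2_add dp_d2_scale dp_mult_add_left dp_mult_add_right
      dp_mult_scale_left dp_mult_scale_right dp.scale_right_diff_distrib)
qed

section \<open>The multiplication table\<close>

text \<open>
  The element \<open>u(x) y\<^sup>(\<^sup>j\<^sup>)\<close>, for a divided power series \<open>u\<close> in \<open>x\<close> given by its coefficients.
\<close>

definition dp_tensor :: "(nat \<Rightarrow> 'a::field) \<Rightarrow> nat \<Rightarrow> 'a dp" where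
  "dp_tensor u j = (\<lambda>i l. if l = j then u i else 0)"

definition dp_conv :: "(nat \<Rightarrow> 'a::field) \<Rightarrow> (nat \<Rightarrow> 'a) \<Rightarrow> nat \<Rightarrow> 'a" where
  "dp_conv u v i = (\<Sum>k\<le>i. of_nat (i choose k) * u k * v (i - k))"

lemma dp_mult_tensor:
  fixes u v :: "nat \<Rightarrow> 'a::field"
  shows "dp_mult n1 n2 (dp_tensor u j) (dp_tensor v l) =
    (if j + l < CHAR('a) ^ n2
     then dp_scale (of_nat (j + l choose j))
       (dp_tensor (\<lambda>i. if i < CHAR('a) ^ n1 then dp_conv u v i else 0) (j + l))
     else 0)"
proof (intro ext)
  fix i m
  have *: "(\<Sum>b\<le>m. of_nat (i choose k) * of_nat (m choose b) * dp_tensor u j k b *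
      dp_tensor v l (i - k) (m - b)) =
    (if m = j + l then of_nat (j + l choose j) * (of_nat (i choose k) * u k * v (i - k)) else 0)"
    for k
  proof -
    have "(\<Sum>b\<le>m. of_nat (i choose k) * of_nat (m choose b) * dp_tensor u j k b *
        dp_tensor v l (i - k) (m - b)) =
      (\<Sum>b\<le>m. if b = j then if m = j + l then
         of_nat (j + l choose j) * (of_nat (i choose k) * u k * v (i - k)) else 0 else 0)"
      by (intro sum.cong refl) (auto simp: dp_tensor_def)
    then show ?thesis by simp
  qed
  show "dp_mult n1 n2 (dp_tensor u j) (dp_tensor v l) i m =
    (if j + l < CHAR('a) ^ n2
     then dp_scale (of_nat (j + l choose j))
       (dp_tensor (\<lambda>i. if i < CHAR('a) ^ n1 then dp_conv u v i else 0) (j + l))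
     else 0) i m"
    unfolding dp_mult_def * by (auto simp: dp_scale_def dp_tensor_def dp_conv_def sum_distrib_left)
qed

text \<open>
  The structure constant of \<open>y\<^sup>(\<^sup>j\<^sup>-\<^sup>1\<^sup>) \<cdot> y\<^sup>(\<^sup>l\<^sup>)\<close>; for \<open>j = 0\<close> it is \<open>0\<close> in accordance with
  \<open>y\<^sup>(\<^sup>-\<^sup>1\<^sup>) = 0\<close>.
\<close>

definition shifted_choose :: "nat \<Rightarrow> nat \<Rightarrow> nat" where
  "shifted_choose j l = (if j = 0 then 0 else (j + l - 1) choose l)"

lemma shifted_choose_absorb: "shifted_choose j l * l = shifted_choose l j * j"
proof (cases "j = 0 \<or> l = 0")
  case False
  then obtain a b where ab: "j = Suc a" "l = Suc b" by (meson not0_implies_Suc)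
  have "(Suc (a + b) choose Suc b) * Suc b = Suc (a + b) * ((a + b) choose b)"
    using Suc_times_binomial[of b "a + b"] by (simp add: mult.commute)
  moreover have "(Suc (a + b) choose Suc a) * Suc a = Suc (a + b) * ((a + b) choose a)"
    using Suc_times_binomial[of a "a + b"] by (simp add: mult.commute)
  moreover have "(a + b) choose a = (a + b) choose b"
    by (metis add_diff_cancel_left' binomial_symmetric le_add1)
  ultimately show ?thesis using ab by (simp add: shifted_choose_def add.commute)
qed (auto simp: shifted_choose_def)

lemma dp_d2_tensor_mult:
  fixes u v :: "nat \<Rightarrow> 'a::field"
  shows "dp_mult n1 n2 (dp_d2 (dp_tensor u j)) (dp_tensor v l) =
    (if j + l - 1 < CHAR('a) ^ n2
     then dp_scale (of_nat (shifted_choose j l))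
       (dp_tensor (\<lambda>i. if i < CHAR('a) ^ n1 then dp_conv u v i else 0) (j + l - 1))
     else 0)"
proof (cases j)
  case 0
  have "dp_d2 (dp_tensor u j) = 0"
    using 0 by (auto simp: dp_d2_def dp_tensor_def fun_eq_iff)
  then have "dp_mult n1 n2 (dp_d2 (dp_tensor u j)) (dp_tensor v l) = 0"
    by (simp add: dp_mult_commute[of _ _ 0])
  then show ?thesis using 0 by (simp add: shifted_choose_def)
next
  case (Suc a)
  have "dp_d2 (dp_tensor u j) = dp_tensor u a"
    using Suc by (auto simp: dp_d2_def dp_tensor_def fun_eq_iff)
  moreover have "(a + l choose a) = (a + l choose l)"
    by (metis add_diff_cancel_left' binomial_symmetric le_add1)
  ultimately show ?thesis using Suc by (simp add: dp_mult_tensor shifted_choose_def)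
qed

lemma dp_conv_commute: "dp_conv u v = dp_conv v u"
proof
  fix i
  show "dp_conv u v i = dp_conv v u i"
    unfolding dp_conv_def
    by (rule sum.reindex_bij_witness[of _ "\<lambda>k. i - k" "\<lambda>k. i - k"])
      (auto simp: binomial_symmetric[symmetric] mult_ac)
qed

lemma dp_tensor_mult_d2:
  fixes u v :: "nat \<Rightarrow> 'a::field"
  shows "dp_mult n1 n2 (dp_tensor u j) (dp_d2 (dp_tensor v l)) =
    (if j + l - 1 < CHAR('a) ^ n2
     then dp_scale (of_nat (shifted_choose l j))
       (dp_tensor (\<lambda>i. if i < CHAR('a) ^ n1 then dp_conv u v i else 0) (j + l - 1))
     else 0)"
  by (simp add: dp_mult_commute[of _ _ "dp_tensor u j"] dp_d2_tensor_mult dp_conv_commute[of u v]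
      add.commute cong: if_cong)

text \<open>
  Up to the top degree, the first factor is a truncated exponential with a correction at \<open>p - 1\<close>, and the
  second has the form of \<open>\<partial>\<^sub>1\<close> of such a series, where the corrections sit at \<open>p - 1\<close> and \<open>p - 2\<close>. The
  binomial theorem gives the main term. Of the correction terms only those survive that meet a constant
  or, for \<open>C\<close>, a linear coefficient of the other factor; the latter brings in \<open>p - 1 = - 1\<close>.
\<close>

lemma dp_conv_exp:
  fixes \<alpha> \<beta> A B C b :: "'a::field"
  assumes "CHAR('a) = p" "p \<ge> 3" "i < p"
  shows "dp_conv (\<lambda>k. \<alpha> ^ k + (if k = p - 1 then A else 0))
      (\<lambda>k. b * \<beta> ^ k + (if k = p - 1 then B else 0) + (if k = p - 2 then C else 0)) i =
    b * (\<alpha> + \<beta>) ^ i + (if i = p - 1 then A * b + B - C * \<alpha> else 0) + (if i = p - 2 then C else 0)"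
    (is "?L = _")
proof -
  have p1: "of_nat (p - Suc 0) = (- 1 :: 'a)"
    using assms by (simp add: of_nat_diff flip: assms(1))
  have "?L = (\<Sum>k\<le>i. b * (of_nat (i choose k) * \<alpha> ^ k * \<beta> ^ (i - k)) +
      (if k = p - 1 then A * b else 0) +
      (if k = 0 then (if i = p - 1 then B else 0) + (if i = p - 2 then C else 0) else 0) +
      (if k = 1 then if i = p - 1 then - C * \<alpha> else 0 else 0))"
    unfolding dp_conv_def
  proof (intro sum.cong refl)
    fix k assume "k \<in> {..i}"
    then have k: "k \<le> i" "k < p" using assms by auto
    consider "k = 0" | "k = 1" | "k = p - 1" | "k > 1" "k < p - 1"
      using k by linarith
    then show "of_nat (i choose k) * (\<alpha> ^ k + (if k = p - 1 then A else 0)) *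
      (b * \<beta> ^ (i - k) + (if i - k = p - 1 then B else 0) + (if i - k = p - 2 then C else 0)) =
      b * (of_nat (i choose k) * \<alpha> ^ k * \<beta> ^ (i - k)) +
      (if k = p - 1 then A * b else 0) +
      (if k = 0 then (if i = p - 1 then B else 0) + (if i = p - 2 then C else 0) else 0) +
      (if k = 1 then if i = p - 1 then - C * \<alpha> else 0 else 0)"
    proof cases
      case 2
      have "i - 1 = p - 2 \<longleftrightarrow> i = p - 1" "i - 1 \<noteq> p - 1" using 2 k assms by auto
      then show ?thesis using 2 assms p1 by (auto simp: algebra_simps)
    next
      case 3
      then have "i = p - 1" using k assms by auto
      then show ?thesis using 3 assms by (auto simp: algebra_simps)
    next
      case 4
      have "i - k \<noteq> p - 2" "i - k \<noteq> p - 1" using 4 assms k by auto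
      then show ?thesis using 4 by (auto simp: algebra_simps)
    qed (use assms in \<open>auto simp: algebra_simps\<close>)
  qed
  also have "\<dots> = b * (\<alpha> + \<beta>) ^ i + (if i = p - 1 then A * b else 0) +
      ((if i = p - 1 then B else 0) + (if i = p - 2 then C else 0)) +
      (if i = p - 1 then - C * \<alpha> else 0)"
    using assms by (auto simp: sum.distrib binomial_ring[of \<alpha>] sum_distrib_left)
  finally show ?thesis by auto
qed

lemma dp_conv_cong:
  "(\<And>k. k \<le> i \<Longrightarrow> u k = u' k) \<Longrightarrow> (\<And>k. k \<le> i \<Longrightarrow> v k = v' k) \<Longrightarrow> dp_conv u v i = dp_conv u' v' i"
  unfolding dp_conv_def by (intro sum.cong refl) auto

text \<open>
  The \<open>x\<close>-part of \<open>e\<^bsub>1-j,\<alpha>\<^esub>\<close>.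
\<close>

definition ham_profile :: "'a::field \<Rightarrow> nat \<Rightarrow> 'a \<Rightarrow> nat \<Rightarrow> 'a" where
  "ham_profile \<sigma> j \<alpha> i = (if i < CHAR('a) then \<alpha> ^ i else 0) +
     (if i = CHAR('a) - 1 then \<sigma> ^ (CHAR('a) - 1) * of_nat j else 0)"

lemma sum_fun_apply: "(\<Sum>x\<in>A. f x) y = (\<Sum>x\<in>A. f x y)"
  by (induction A rule: infinite_finite_induct) auto

lemma ham_e_eq_tensor:
  assumes "CHAR('a::field) > 0"
  shows "ham_e \<sigma> (1 - int j) (\<alpha>::'a) = dp_tensor (ham_profile \<sigma> j \<alpha>) j"
proof (intro ext)
  fix i l
  have "(\<Sum>k = 0..CHAR('a) - 1. dp_scale (\<alpha> ^ k) (dp_monom k j)) i l =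
    (\<Sum>k = 0..CHAR('a) - 1. if k = i then if l = j then \<alpha> ^ i else 0 else 0)"
    unfolding sum_fun_apply by (intro sum.cong refl) (auto simp: dp_scale_def dp_monom_def)
  also have "\<dots> = (if i < CHAR('a) \<and> l = j then \<alpha> ^ i else 0)"
    using assms by (auto simp: sum.delta)
  finally show "ham_e \<sigma> (1 - int j) \<alpha> i l = dp_tensor (ham_profile \<sigma> j \<alpha>) j i l"
    by (auto simp: ham_e_def dp_tensor_def ham_profile_def dp_scale_def dp_monom_def)
qed

lemma ham_e_in_dp_space:
  assumes "prime CHAR('a::field)" "j < CHAR('a) ^ n"
  shows "ham_e \<sigma> (1 - int j) (\<alpha>::'a) \<in> dp_space 1 n"
proof -
  have "CHAR('a) > 0" using assms(1) prime_gt_0_nat by blast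
  then show ?thesis
    using assms(2) by (auto simp: ham_e_eq_tensor dp_space_def dp_tensor_def ham_profile_def)
qed

text \<open>
  The heart of the matter. Writing \<open>c\<close>, \<open>d\<close> for the two structure constants in \<open>y\<close>, the coefficients in
  degree below \<open>p - 2\<close> in \<open>x\<close> give the scalar \<open>c \<beta> - d \<alpha>\<close>. In degree \<open>p - 2\<close> there is an
  extra \<open>\<sigma>\<^sup>p\<^sup>-\<^sup>1 (c l - d j)\<close>, which is zero by \<open>shifted_choose_absorb\<close>. In degree \<open>p - 1\<close> the contributions of
  \<open>\<alpha>\<^sup>p\<close>, \<open>\<beta>\<^sup>p\<close>, the corrections and the twist of the bracket have to add up to the correction of the
  right-hand side; the assumed equations for \<open>\<alpha>\<^sup>p\<close> and \<open>\<beta>\<^sup>p\<close> are what makes them do so.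
\<close>

lemma ham_bracket_ham_e:
  fixes \<sigma> \<alpha> \<beta> :: "'a::field" and j l :: nat
  assumes p: "CHAR('a) = p" "prime p" "odd p"
    and \<alpha>: "\<alpha> ^ p = \<sigma> ^ (p - 1) * \<alpha> + (1 - of_nat j)"
    and \<beta>: "\<beta> ^ p = \<sigma> ^ (p - 1) * \<beta> + (1 - of_nat l)"
  shows "ham_bracket 1 n (ham_e \<sigma> (1 - int j) \<alpha>) (ham_e \<sigma> (1 - int l) \<beta>) =
    (if j + l - 1 < p ^ n
     then dp_scale (of_nat (shifted_choose j l) * \<beta> - of_nat (shifted_choose l j) * \<alpha>)
       (ham_e \<sigma> (1 - int (j + l - 1)) (\<alpha> + \<beta>))
     else 0)"
proof -
  have p3: "p \<ge> 3"
    using prime_ge_2_nat[OF p(2)] p(3) by (cases "p = 2") auto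
  define \<tau> where "\<tau> = \<sigma> ^ (p - 1)"
  define u where "u = ham_profile \<sigma> j \<alpha>"
  define v where "v = ham_profile \<sigma> l \<beta>"
  define x where "x = (\<lambda>i. if i = p - 1 then 1 else 0 :: 'a)"
  define cut where "cut w = (\<lambda>i. if i < p then w i else 0 :: 'a)" for w
  define c where "c = (of_nat (shifted_choose j l) :: 'a)"
  define d where "d = (of_nat (shifted_choose l j) :: 'a)"
  have e: "ham_e \<sigma> (1 - int j) \<alpha> = dp_tensor u j" "ham_e \<sigma> (1 - int l) \<beta> = dp_tensor v l"
    "ham_e \<sigma> (1 - int (j + l - 1)) (\<alpha> + \<beta>) = dp_tensor (ham_profile \<sigma> (j + l - 1) (\<alpha> + \<beta>)) (j + l - 1)"
    unfolding u_def v_def by (rule ham_e_eq_tensor; use p3 p in simp)+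
  have d1: "dp_d1 (dp_tensor w m) = dp_tensor (\<lambda>i. w (Suc i)) m" for w :: "nat \<Rightarrow> 'a" and m
    by (auto simp: dp_d1_def dp_tensor_def fun_eq_iff)
  have x: "dp_monom (p - Suc 0) 0 = dp_tensor x 0"
    using p by (auto simp: dp_monom_def dp_tensor_def x_def fun_eq_iff)
  show ?thesis
  proof (cases "j + l - 1 < p ^ n")
    case True
    have br: "ham_bracket 1 n (ham_e \<sigma> (1 - int j) \<alpha>) (ham_e \<sigma> (1 - int l) \<beta>) =
      dp_scale c (dp_tensor (cut (dp_conv u (\<lambda>i. v (Suc i)))) (j + l - 1)) -
      dp_scale d (dp_tensor (cut (dp_conv (\<lambda>i. u (Suc i)) v)) (j + l - 1)) +
      dp_scale (c - d) (dp_tensor (cut (dp_conv x (cut (dp_conv u v)))) (j + l - 1))"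
      using True p
      by (simp add: ham_bracket_def e x d1 dp_d2_tensor_mult dp_tensor_mult_d2 dp_mult_tensor
          dp_mult_diff_right dp_mult_scale_right dp.scale_left_diff_distrib c_def d_def cut_def)
    have "dp_conv u (\<lambda>i. v (Suc i)) i =
        dp_conv (\<lambda>k. \<alpha> ^ k + (if k = p - 1 then \<tau> * of_nat j else 0))
         (\<lambda>k. \<beta> * \<beta> ^ k + (if k = p - 1 then - (\<beta> ^ p) else 0) + (if k = p - 2 then \<tau> * of_nat l else 0)) i"
      if "i < p" for i
      using that p p3
      by (intro dp_conv_cong) (auto simp: u_def v_def ham_profile_def \<tau>_def power_Suc[symmetric] simp del: power_Suc)
    then have uv': "dp_conv u (\<lambda>i. v (Suc i)) i = \<beta> * (\<alpha> + \<beta>) ^ i +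
        (if i = p - 1 then \<tau> * of_nat j * \<beta> - \<beta> ^ p - \<tau> * of_nat l * \<alpha> else 0) +
        (if i = p - 2 then \<tau> * of_nat l else 0)"
      if "i < p" for i
      using that dp_conv_exp[OF p(1) p3 that, of \<alpha> "\<tau> * of_nat j" \<beta> \<beta> "- (\<beta> ^ p)" "\<tau> * of_nat l"]
      by simp
    have "dp_conv (\<lambda>i. u (Suc i)) v i =
        dp_conv (\<lambda>k. \<beta> ^ k + (if k = p - 1 then \<tau> * of_nat l else 0))
         (\<lambda>k. \<alpha> * \<alpha> ^ k + (if k = p - 1 then - (\<alpha> ^ p) else 0) + (if k = p - 2 then \<tau> * of_nat j else 0)) i"
      if "i < p" for i
      unfolding dp_conv_commute[of _ v] using that p p3
      by (intro dp_conv_cong) (auto simp: u_def v_def ham_profile_def \<tau>_def power_Suc[symmetric] simp del: power_Suc)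
    then have u'v: "dp_conv (\<lambda>i. u (Suc i)) v i = \<alpha> * (\<alpha> + \<beta>) ^ i +
        (if i = p - 1 then \<tau> * of_nat l * \<alpha> - \<alpha> ^ p - \<tau> * of_nat j * \<beta> else 0) +
        (if i = p - 2 then \<tau> * of_nat j else 0)"
      if "i < p" for i
      using that dp_conv_exp[OF p(1) p3 that, of \<beta> "\<tau> * of_nat l" \<alpha> \<alpha> "- (\<alpha> ^ p)" "\<tau> * of_nat j"]
      by (simp add: add.commute[of \<beta>])
    have xuv: "dp_conv x (cut (dp_conv u v)) i = (if i = p - 1 then 1 else 0)" if "i < p" for i
    proof -
      have "dp_conv x (cut (dp_conv u v)) i =
        (\<Sum>k\<le>i. if k = p - 1 then of_nat (i choose k) * cut (dp_conv u v) (i - k) else 0)"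
        unfolding dp_conv_def[of x] by (intro sum.cong refl) (auto simp: x_def)
      also have "\<dots> = (if i = p - 1 then cut (dp_conv u v) 0 else 0)"
        using that by (auto simp: sum.delta)
      also have "cut (dp_conv u v) 0 = 1"
        using p p3 by (auto simp: cut_def dp_conv_def u_def v_def ham_profile_def)
      finally show ?thesis .
    qed
    have cd: "c * of_nat l = d * of_nat j"
      unfolding c_def d_def by (metis of_nat_mult shifted_choose_absorb)
    have *: "c * dp_conv u (\<lambda>i. v (Suc i)) i - d * dp_conv (\<lambda>i. u (Suc i)) v i +
       (c - d) * dp_conv x (cut (dp_conv u v)) i =
       (c * \<beta> - d * \<alpha>) * ham_profile \<sigma> (j + l - 1) (\<alpha> + \<beta>) i" if i: "i < p" for i
    proof -
      consider "i < p - 2" | "i = p - 2" | "i = p - 1" using i by linarith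
      then show ?thesis
      proof cases
        case 1
        then have "i \<noteq> p - 1" by auto
        then show ?thesis
          using 1 i p uv' u'v xuv by (simp add: ham_profile_def algebra_simps)
      next
        case 2
        then have "i \<noteq> p - 1" using p3 by auto
        then show ?thesis
          using i p uv' u'v xuv cd 2 by (simp add: ham_profile_def algebra_simps)
      next
        case 3
        then have i': "i \<noteq> p - 2" using p3 by auto
        \<comment> \<open>For \<open>j = l = 0\<close> the subtraction is truncated, but then \<open>c\<close> and \<open>d\<close> vanish.\<close>
        have jl: "(c * \<beta> - d * \<alpha>) * of_nat (j + l - 1) = (c * \<beta> - d * \<alpha>) * (of_nat j + of_nat l - 1)"
          by (cases "j + l = 0") (auto simp: c_def d_def shifted_choose_def of_nat_diff)
        have "ham_profile \<sigma> (j + l - 1) (\<alpha> + \<beta>) i = (\<alpha> + \<beta>) ^ i + \<tau> * of_nat (j + l - 1)"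
          using i p 3 by (simp add: ham_profile_def \<tau>_def)
        then have "(c * \<beta> - d * \<alpha>) * ham_profile \<sigma> (j + l - 1) (\<alpha> + \<beta>) i =
          (c * \<beta> - d * \<alpha>) * (\<alpha> + \<beta>) ^ i + \<tau> * ((c * \<beta> - d * \<alpha>) * (of_nat j + of_nat l - 1))"
          by (simp only: jl[symmetric] distrib_left mult.left_commute[of \<tau>])
        moreover have "c * (\<tau> * of_nat j * \<beta> - \<beta> ^ p - \<tau> * of_nat l * \<alpha>) +
          (c - d - d * (\<tau> * of_nat l * \<alpha> - \<alpha> ^ p - \<tau> * of_nat j * \<beta>)) =
          \<tau> * ((c * \<beta> - d * \<alpha>) * (of_nat j + of_nat l - 1))"
          unfolding \<alpha> \<beta> \<tau>_def[symmetric] using cd by algebra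
        moreover have "c * (\<beta> * g + A) - d * (\<alpha> * g + B) + (c - d) = (c * \<beta> - d * \<alpha>) * g + (c * A - d * B + (c - d))"
          for g A B by (simp add: algebra_simps)
        ultimately show ?thesis
          using i i' 3 uv'[OF i] u'v[OF i] xuv[OF i] by simp
      qed
    qed
    have **: "ham_profile \<sigma> (j + l - 1) (\<alpha> + \<beta>) i = 0" if "\<not> i < p" for i
      using that p p3 by (auto simp: ham_profile_def)
    show ?thesis
      unfolding br unfolding e using True * **
      by (auto simp: fun_eq_iff dp_scale_def dp_tensor_def cut_def simp flip: c_def d_def)
  next
    case False
    then show ?thesis
      using p by (simp add: ham_bracket_def e d1 dp_d2_tensor_mult dp_tensor_mult_d2)
  qed
qed

section \<open>Spans and direct sums\<close>

lemma (in vector_space) independent_if_dual: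
  assumes "\<And>b. b \<in> B \<Longrightarrow> \<exists>\<phi> :: 'b \<Rightarrow> 'a. (\<forall>x y. \<phi> (x + y) = \<phi> x + \<phi> y) \<and>
    (\<forall>c x. \<phi> (scale c x) = c * \<phi> x) \<and> \<phi> b \<noteq> 0 \<and> (\<forall>b'\<in>B - {b}. \<phi> b' = 0)"
  shows "independent B"
proof
  assume "dependent B"
  then obtain b where b: "b \<in> B" "b \<in> span (B - {b})" by (auto simp: dependent_def)
  obtain \<phi> :: "'b \<Rightarrow> 'a" where \<phi>: "\<And>x y. \<phi> (x + y) = \<phi> x + \<phi> y" "\<And>c x. \<phi> (scale c x) = c * \<phi> x"
    "\<phi> b \<noteq> 0" "\<And>b'. b' \<in> B - {b} \<Longrightarrow> \<phi> b' = 0"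
    using assms[OF b(1)] by blast
  have "\<phi> 0 = 0" using \<phi>(2)[of 0 0] by simp
  then have "subspace {x. \<phi> x = 0}" using \<phi> by (auto simp: subspace_def)
  then have "span (B - {b}) \<subseteq> {x. \<phi> x = 0}" using \<phi>(4) by (intro span_minimal) auto
  then show False using b \<phi>(3) by blast
qed

lemma (in vector_space) span_pair: "span {a, b} = {scale s a + scale t b | s t. True}"
proof -
  have "x - scale s a = scale t b \<longleftrightarrow> x = scale s a + scale t b" for x s t
    by (simp add: diff_eq_eq add.commute)
  then show ?thesis by (auto simp: span_insert span_singleton image_iff)
qed

lemma (in vector_space) span_pair_scale:
  "c \<noteq> 0 \<Longrightarrow> d \<noteq> 0 \<Longrightarrow> span {scale c a, scale d b} = span {a, b}"
  unfolding span_eq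
  using span_scale[OF span_base[of "scale c a" "{scale c a, scale d b}"], of "inverse c"]
    span_scale[OF span_base[of "scale d b" "{scale c a, scale d b}"], of "inverse d"]
  by (auto intro: span_scale span_base)

lemma (in vector_space) span_pair_multiples:
  assumes "c \<noteq> 0 \<or> d \<noteq> 0"
  shows "span {scale c a, scale d a} = span {a}"
proof -
  have "a \<in> span {scale c a, scale d a}"
    using span_scale[OF span_base[of "scale c a" "{scale c a, scale d a}"], of "inverse c"]
      span_scale[OF span_base[of "scale d a" "{scale c a, scale d a}"], of "inverse d"] assms
    by auto
  then show ?thesis
    unfolding span_eq by (auto intro: span_scale span_base)
qed

text \<open>
  The finitely supported families on which \<open>is_direct_sum\<close> requires summation to be bijective.
\<close>

definition direct_sum_families :: "'i set \<Rightarrow> ('i \<Rightarrow> 'v::ab_group_add set) \<Rightarrow> ('i \<Rightarrow> 'v) set" where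
  "direct_sum_families I V =
     {f. finite {i. f i \<noteq> 0} \<and> (\<forall>i\<in>I. f i \<in> V i) \<and> (\<forall>i. i \<notin> I \<longrightarrow> f i = 0)}"

lemma is_direct_sum_alt:
  "is_direct_sum I V L \<longleftrightarrow> bij_betw (\<lambda>f. \<Sum>i | f i \<noteq> 0. f i) (direct_sum_families I V) L"
  by (simp add: is_direct_sum_def direct_sum_families_def)

lemma (in vector_space) representation_eq_0_outside:
  assumes "independent B" "P \<subseteq> B" "v \<in> span P" "b \<notin> P"
  shows "representation B v b = 0"
  using representation_extend[OF assms(1,3,2)] representation_ne_zero[of P v b] assms(4) by auto

text \<open>
  Coordinates with respect to the basis recover the summands: for a basis vector of the block \<open>P i\<close>, its
  coordinate in the sum of a family equals that in the \<open>i\<close>-th member.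
\<close>

lemma (in vector_space) is_direct_sum_span_partition:
  assumes B: "independent B" "B = (\<Union>i\<in>I. P i)"
    and disj: "\<And>i j. i \<in> I \<Longrightarrow> j \<in> I \<Longrightarrow> i \<noteq> j \<Longrightarrow> P i \<inter> P j = {}"
  shows "is_direct_sum I (\<lambda>i. span (P i)) (span B)"
proof -
  let ?F = "direct_sum_families I (\<lambda>i. span (P i))" and ?R = "representation B"
  have PB: "P i \<subseteq> B" if "i \<in> I" for i using that B by auto
  have F_span: "f i \<in> span B" if "f \<in> ?F" for f i
    using that span_mono[OF PB] by (cases "i \<in> I") (auto simp: direct_sum_families_def span_zero)
  have rep: "?R (\<Sum>k | f k \<noteq> 0. f k) b = ?R (f i) b" if f: "f \<in> ?F" and i: "i \<in> I" "b \<in> P i" for f i b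
  proof -
    have fin: "finite {k. f k \<noteq> 0}" using f by (simp add: direct_sum_families_def)
    have 0: "?R (f k) b = 0" if "k \<noteq> i" for k
    proof (cases "k \<in> I")
      case True
      then show ?thesis
        using f i disj[of k i] that
        by (intro representation_eq_0_outside[OF B(1) PB]) (auto simp: direct_sum_families_def)
    next
      case False
      then show ?thesis using f by (simp add: direct_sum_families_def representation_zero)
    qed
    have "?R (\<Sum>k | f k \<noteq> 0. f k) b = (\<Sum>k | f k \<noteq> 0. ?R (f k) b)"
      by (subst representation_sum[OF B(1)]) (auto intro: F_span[OF f])
    also have "\<dots> = (\<Sum>k\<in>insert i {k. f k \<noteq> 0}. ?R (f k) b)"
      using fin by (intro sum.mono_neutral_left) (auto simp: representation_zero)
    also have "\<dots> = ?R (f i) b"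
      using fin 0 by (subst sum.remove[of _ i]) (auto intro!: sum.neutral)
    finally show ?thesis .
  qed
  have inj: "f = g" if fg: "f \<in> ?F" "g \<in> ?F" "(\<Sum>k | f k \<noteq> 0. f k) = (\<Sum>k | g k \<noteq> 0. g k)" for f g
  proof
    fix i
    show "f i = g i"
    proof (cases "i \<in> I")
      case True
      have "?R (f i) b = ?R (g i) b" for b
      proof (cases "b \<in> P i")
        case True
        then show ?thesis using rep[OF fg(1) \<open>i \<in> I\<close>] rep[OF fg(2) \<open>i \<in> I\<close>] fg(3) by metis
      next
        case False
        then show ?thesis
          using fg True representation_eq_0_outside[OF B(1) PB[OF True]]
          by (auto simp: direct_sum_families_def)
      qed
      then have "?R (f i) = ?R (g i)" by blast
      then show ?thesis
        using sum_nonzero_representation_eq[OF B(1) F_span[OF fg(1), of i]]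
          sum_nonzero_representation_eq[OF B(1) F_span[OF fg(2), of i]] by metis
    qed (use fg in \<open>auto simp: direct_sum_families_def\<close>)
  qed
  have surj: "\<exists>f\<in>?F. (\<Sum>k | f k \<noteq> 0. f k) = v" if v: "v \<in> span B" for v
  proof -
    define A where "A = {b. ?R v b \<noteq> 0}"
    have A: "finite A" "A \<subseteq> B"
      unfolding A_def by (auto simp: finite_representation intro: representation_ne_zero)
    define J where "J = {i \<in> I. A \<inter> P i \<noteq> {}}"
    define f where "f i = (if i \<in> I then \<Sum>b\<in>A \<inter> P i. ?R v b *s b else 0)" for i
    have "finite {i \<in> I. b \<in> P i}" for b
    proof (cases "\<exists>i\<in>I. b \<in> P i")
      case True
      then obtain i where i: "i \<in> I" "b \<in> P i" by blast
      then have "{i \<in> I. b \<in> P i} \<subseteq> {i}" using disj[of i] by blast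
      then show ?thesis using finite_subset by blast
    next
      case False
      then have "{i \<in> I. b \<in> P i} = {}" by blast
      then show ?thesis by (metis finite.emptyI)
    qed
    then have "finite (\<Union>b\<in>A. {i \<in> I. b \<in> P i})" using A by blast
    moreover have "J = (\<Union>b\<in>A. {i \<in> I. b \<in> P i})" by (auto simp: J_def)
    ultimately have J: "finite J" by simp
    have f_J: "f i = 0" if "i \<notin> J" for i
      using that by (auto simp: f_def J_def)
    have fin: "finite {i. f i \<noteq> 0}"
      using J f_J by (metis (mono_tags, lifting) finite_subset mem_Collect_eq subsetI)
    have "(\<Sum>b\<in>A \<inter> P i. ?R v b *s b) \<in> span (P i)" for i
      by (rule span_sum) (auto intro: span_scale span_base)
    then have "f \<in> ?F"
      using fin by (auto simp: direct_sum_families_def f_def)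
    moreover have "(\<Sum>k | f k \<noteq> 0. f k) = v"
    proof -
      have "(\<Sum>k | f k \<noteq> 0. f k) = (\<Sum>k\<in>J. f k)"
        using J f_J by (intro sum.mono_neutral_left) auto
      also have "\<dots> = (\<Sum>k\<in>J. \<Sum>b\<in>A \<inter> P k. ?R v b *s b)"
        by (intro sum.cong) (auto simp: f_def J_def)
      also have "\<dots> = (\<Sum>b\<in>(\<Union>k\<in>J. A \<inter> P k). ?R v b *s b)"
        using J A disj by (subst sum.UNION_disjoint) (auto simp: J_def)
      also have "(\<Union>k\<in>J. A \<inter> P k) = A" using A(2) unfolding B(2) J_def by blast
      finally show ?thesis
        using sum_nonzero_representation_eq[OF B(1) v] by (simp add: A_def)
    qed
    ultimately show ?thesis by blast
  qed
  have in_span: "(\<Sum>k | f k \<noteq> 0. f k) \<in> span B" if "f \<in> ?F" for f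
    by (intro span_sum F_span[OF that])
  show ?thesis
    unfolding is_direct_sum_alt bij_betw_def
  proof
    show "inj_on (\<lambda>f. \<Sum>i | f i \<noteq> 0. f i) ?F"
      by (intro inj_onI) (rule inj)
    show "(\<lambda>f. \<Sum>i | f i \<noteq> 0. f i) ` ?F = span B"
      using in_span surj by (auto simp: image_iff)
  qed
qed

text \<open>
  Two decompositions of the same space cannot be properly nested. It is what turns the inclusion of one
  grading into another into equality.
\<close>

lemma direct_sum_components_eq:
  assumes S: "is_direct_sum I S L" and S': "is_direct_sum I S' L"
    and sub: "\<And>i. i \<in> I \<Longrightarrow> S i \<subseteq> S' i" and zero: "\<And>i. i \<in> I \<Longrightarrow> 0 \<in> S' i" and k: "k \<in> I"
  shows "S k = S' k"
proof
  show "S k \<subseteq> S' k" by (rule sub[OF k])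
  show "S' k \<subseteq> S k"
  proof
    fix v assume v: "v \<in> S' k"
    define g where "g = (\<lambda>i. if i = k then v else 0)"
    have supp: "{i. g i \<noteq> 0} \<subseteq> {k}" by (auto simp: g_def)
    then have g: "g \<in> direct_sum_families I S'"
      using v zero k finite_subset[OF supp] by (auto simp: direct_sum_families_def g_def)
    have "(\<Sum>i | g i \<noteq> 0. g i) = (\<Sum>i\<in>{k}. g i)"
      by (intro sum.mono_neutral_left) (auto simp: g_def)
    then have gv: "(\<Sum>i | g i \<noteq> 0. g i) = v" by (simp add: g_def)
    then have "v \<in> L" using bij_betwE[OF S'[unfolded is_direct_sum_alt]] g by metis
    then have "v \<in> (\<lambda>f. \<Sum>i | f i \<noteq> 0. f i) ` direct_sum_families I S"
      using S[unfolded is_direct_sum_alt] by (simp add: bij_betw_def)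
    then obtain f where f: "f \<in> direct_sum_families I S" "(\<Sum>i | f i \<noteq> 0. f i) = v" by blast
    then have "f \<in> direct_sum_families I S'" using sub by (auto simp: direct_sum_families_def)
    then have "f = g"
      using bij_betw_imp_inj_on[OF S'[unfolded is_direct_sum_alt]] g f(2) gv
      by (auto dest: inj_onD)
    then have "f k = v" by (simp add: g_def)
    then show "v \<in> S k" using f k by (auto simp: direct_sum_families_def)
  qed
qed

section \<open>Polynomial extensions of Lie algebras\<close>

lemma lie_algebra_subalgebra:
  assumes "lie_algebra scale L br" "lie_subalgebra scale L br K"
  shows "lie_algebra scale K br"
proof -
  interpret lie_algebra scale L br by fact
  have K: "subspace K" "K \<subseteq> L" "\<And>x y. x \<in> K \<Longrightarrow> y \<in> K \<Longrightarrow> br x y \<in> K"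
    using assms(2) by (auto simp: lie_subalgebra_def)
  show ?thesis
    by standard (use K br_add_left br_add_right br_scale_left br_scale_right br_self jacobi in
      \<open>auto simp: subset_iff\<close>)
qed

text \<open>
  The middle term is a separate assumption so that the lemma can be used in characteristic \<open>2\<close>, where
  \<open>s + s = 0\<close> says nothing about \<open>s\<close>.
\<close>

lemma sum_antisymmetric_eq_0:
  fixes s :: "nat \<Rightarrow> 'v::ab_group_add"
  assumes "\<And>i. i \<le> m \<Longrightarrow> s i + s (m - i) = 0" and "\<And>i. i + i = m \<Longrightarrow> s i = 0"
  shows "(\<Sum>i\<le>m. s i) = 0"
proof -
  have "(\<Sum>i\<le>m. s i) = (\<Sum>i | i + i < m. s i) + (\<Sum>i | i + i > m \<and> i \<le> m. s i) + (\<Sum>i | i + i = m. s i)"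
  proof -
    have fin: "finite {i. i + i < m}" "finite {i. i + i > m \<and> i \<le> m}" "finite {i. i + i = m}"
      by (rule finite_subset[of _ "{..m}"]; auto)+
    have "{..m} = ({i. i + i < m} \<union> {i. i + i > m \<and> i \<le> m}) \<union> {i. i + i = m}" by auto
    then show ?thesis
      using fin by (simp only:) (subst sum.union_disjoint; auto)+
  qed
  also have "(\<Sum>i | i + i = m. s i) = 0" using assms(2) by (intro sum.neutral) auto
  also have "(\<Sum>i | i + i > m \<and> i \<le> m. s i) = (\<Sum>i | i + i < m. s (m - i))"
    by (rule sum.reindex_bij_witness[of _ "\<lambda>i. m - i" "\<lambda>i. m - i"]) auto
  also have "(\<Sum>i | i + i < m. s i) + (\<Sum>i | i + i < m. s (m - i)) + 0 =
      (\<Sum>i | i + i < m. s i + s (m - i))"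
    by (simp add: sum.distrib)
  also have "\<dots> = 0" using assms(1) by (intro sum.neutral) auto
  finally show ?thesis .
qed

lemma sum_simplex_eq:
  "(\<Sum>i\<le>m. \<Sum>j\<le>m - i. t i j (m - i - j)) = (\<Sum>(i, j, k) | i + j + k = m. t i j k)"
  for m :: nat
proof -
  have "(\<Sum>i\<le>m. \<Sum>j\<le>m - i. t i j (m - i - j)) =
      (\<Sum>(i, j)\<in>(SIGMA i:{..m}. {..m - i}). t i j (m - i - j))"
    by (subst sum.Sigma) auto
  also have "\<dots> = (\<Sum>(i, j, k) | i + j + k = m. t i j k)"
    by (rule sum.reindex_bij_witness[of _ "\<lambda>(i, j, k). (i, j)" "\<lambda>(i, j). (i, j, m - i - j)"]) auto
  finally show ?thesis .
qed

text \<open>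
  The three double sums in the Jacobi identity of a polynomial extension run over the same triples of degrees,
  cyclically permuted; this aligns them so that the Jacobi identity applies termwise.
\<close>

lemma sum_simplex_rotate:
  "(\<Sum>i\<le>m. \<Sum>j\<le>m - i. t i j (m - i - j)) = (\<Sum>i\<le>m. \<Sum>j\<le>m - i. t (m - i - j) i j)"
  for m :: nat
  unfolding sum_simplex_eq[of t] sum_simplex_eq[of "\<lambda>i j k. t k i j"]
  by (rule sum.reindex_bij_witness[of _ "\<lambda>(i, j, k). (k, i, j)" "\<lambda>(i, j, k). (j, k, i)"]) auto

context lie_algebra
begin

lemma br_zero_left [simp]: "y \<in> L \<Longrightarrow> br 0 y = 0"
  using br_add_left[of 0 0 y] subspace_0[OF subspace_L] by simp

lemma br_zero_right [simp]: "y \<in> L \<Longrightarrow> br y 0 = 0"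
  using br_add_right[of y 0 0] subspace_0[OF subspace_L] by simp

lemma br_antisym: "x \<in> L \<Longrightarrow> y \<in> L \<Longrightarrow> br x y + br y x = 0"
  using br_self[of "x + y"] br_self[of x] br_self[of y] subspace_add[OF subspace_L, of x y]
  by (simp add: br_add_left br_add_right add.commute)

lemma br_sum_right:
  "x \<in> L \<Longrightarrow> (\<And>i. i \<in> A \<Longrightarrow> f i \<in> L) \<Longrightarrow> br x (\<Sum>i\<in>A. f i) = (\<Sum>i\<in>A. br x (f i))"
  by (induction A rule: infinite_finite_induct)
    (auto simp: br_add_right subspace_sum[OF subspace_L])

lemma br_span_closed:
  assumes A: "A \<subseteq> L" and B: "B \<subseteq> L" and W: "subspace W"
    and AB: "\<And>a b. a \<in> A \<Longrightarrow> b \<in> B \<Longrightarrow> br a b \<in> W"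
    and xy: "x \<in> span A" "y \<in> span B"
  shows "br x y \<in> W"
proof -
  note L = subspace_L[unfolded subspace_def] and W' = W[unfolded subspace_def]
  have "subspace {x \<in> L. \<forall>b\<in>B. br x b \<in> W}"
    using L W' B by (auto simp: subspace_def br_add_left br_scale_left subset_iff)
  then have "span A \<subseteq> {x \<in> L. \<forall>b\<in>B. br x b \<in> W}"
    using A AB by (intro span_minimal) auto
  then have x: "x \<in> L" "\<And>b. b \<in> B \<Longrightarrow> br x b \<in> W" using xy by auto
  have "subspace {y \<in> L. br x y \<in> W}"
    using L W' x(1) by (auto simp: subspace_def br_add_right br_scale_right)
  then have "span B \<subseteq> {y \<in> L. br x y \<in> W}"
    using B x by (intro span_minimal) auto
  then show ?thesis using xy by auto
qed

lemma br_image_span_pair: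
  assumes "u \<in> L" "a \<in> L" "b \<in> L"
  shows "br u ` span {a, b} = span {br u a, br u b}"
proof -
  have "br u (scale s a + scale t b) = scale s (br u a) + scale t (br u b)" for s t
    using assms subspace_scale[OF subspace_L] by (simp add: br_add_right br_scale_right)
  then show ?thesis by (auto simp: span_pair image_iff) metis
qed

lemma coeff_loop_scale: "coeff (loop_scale scale c f) k = scale c (coeff f k)"
  by (simp add: loop_scale_def coeff_map_poly)

lemma coeff_loop_bracket:
  assumes f: "f \<in> poly_extension L" and g: "g \<in> poly_extension L"
  shows "coeff (loop_bracket br f g) m = (\<Sum>i\<le>m. br (coeff f i) (coeff g (m - i)))"
proof -
  have fL: "coeff f i \<in> L" and gL: "coeff g i \<in> L" for i
    using f g by (auto simp: poly_extension_def)
  have inner: "(\<Sum>j\<le>degree g. if i + j = m then br (coeff f i) (coeff g j) else 0) =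
      (if i \<le> m then br (coeff f i) (coeff g (m - i)) else 0)" for i
  proof -
    have "(\<Sum>j\<le>degree g. if i + j = m then br (coeff f i) (coeff g j) else 0) =
       (\<Sum>j\<le>degree g. if j = m - i then if i \<le> m then br (coeff f i) (coeff g j) else 0 else 0)"
      by (intro sum.cong) auto
    also have "\<dots> = (if i \<le> m then br (coeff f i) (coeff g (m - i)) else 0)"
      using fL by (auto simp: sum.delta coeff_eq_0)
    finally show ?thesis .
  qed
  have "coeff (loop_bracket br f g) m =
      (\<Sum>i\<le>degree f. if i \<le> m then br (coeff f i) (coeff g (m - i)) else 0)"
    by (simp add: loop_bracket_def coeff_sum inner)
  also have "\<dots> = (\<Sum>i\<le>max m (degree f). if i \<le> m then br (coeff f i) (coeff g (m - i)) else 0)"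
    using gL by (intro sum.mono_neutral_left) (auto simp: coeff_eq_0)
  also have "\<dots> = (\<Sum>i\<le>m. br (coeff f i) (coeff g (m - i)))"
    by (intro sum.mono_neutral_cong_right) auto
  finally show ?thesis .
qed

lemma loop_bracket_in_poly_extension:
  "f \<in> poly_extension L \<Longrightarrow> g \<in> poly_extension L \<Longrightarrow> loop_bracket br f g \<in> poly_extension L"
  unfolding poly_extension_def[of L] mem_Collect_eq
  by (subst coeff_loop_bracket)
    (auto simp: poly_extension_def intro!: subspace_sum[OF subspace_L] br_closed)

lemma vector_space_loop_scale: "vector_space (loop_scale scale)"
  by standard (auto simp: poly_eq_iff coeff_loop_scale scale_right_distrib scale_left_distrib)

lemma coeff_loop_bracket_nested:
  assumes "f \<in> poly_extension L" "g \<in> poly_extension L" "h \<in> poly_extension L"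
  shows "coeff (loop_bracket br f (loop_bracket br g h)) m =
    (\<Sum>i\<le>m. \<Sum>j\<le>m - i. br (coeff f i) (br (coeff g j) (coeff h (m - i - j))))"
proof -
  have L: "coeff f i \<in> L" "coeff g i \<in> L" "coeff h i \<in> L" for i
    using assms by (auto simp: poly_extension_def)
  show ?thesis
    unfolding coeff_loop_bracket[OF assms(1) loop_bracket_in_poly_extension[OF assms(2,3)]]
      coeff_loop_bracket[OF assms(2,3)]
    by (intro sum.cong refl br_sum_right L br_closed)
qed

lemma lie_algebra_poly_extension:
  "lie_algebra (loop_scale scale) (poly_extension L) (loop_bracket br)"
proof -
  interpret loop: vector_space "loop_scale scale" by (rule vector_space_loop_scale)
  note subspace = subspace_L[unfolded subspace_def]
  have sub: "loop.subspace (poly_extension L)"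
    using subspace by (auto simp: loop.subspace_def poly_extension_def coeff_loop_scale)
  have L: "coeff f i \<in> L" if "f \<in> poly_extension L" for f i
    using that by (simp add: poly_extension_def)
  show ?thesis
  proof
    show "loop.subspace (poly_extension L)" by (rule sub)
    show "loop_bracket br f f = 0" if "f \<in> poly_extension L" for f
    proof (rule poly_eqI)
      show "coeff (loop_bracket br f f) m = coeff 0 m" for m
        using that L[OF that]
        by (auto simp: coeff_loop_bracket intro!: sum_antisymmetric_eq_0 br_antisym)
          (metis L add_diff_cancel_right' br_self that)
    qed
    show "loop_bracket br f (loop_bracket br g h) + loop_bracket br g (loop_bracket br h f) +
        loop_bracket br h (loop_bracket br f g) = 0"
      if fgh: "f \<in> poly_extension L" "g \<in> poly_extension L" "h \<in> poly_extension L" for f g h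
    proof (rule poly_eqI)
      fix m
      let ?t = "\<lambda>i j k. br (coeff f i) (br (coeff g j) (coeff h k))"
      let ?u = "\<lambda>i j k. br (coeff g i) (br (coeff h j) (coeff f k))"
      let ?v = "\<lambda>i j k. br (coeff h i) (br (coeff f j) (coeff g k))"
      \<comment> \<open>All three sums are indexed so that \<open>f\<close>, \<open>g\<close>, \<open>h\<close> carry the degrees \<open>i\<close>, \<open>j\<close>, \<open>m - i - j\<close>.\<close>
      have u: "(\<Sum>i\<le>m. \<Sum>j\<le>m - i. ?u i j (m - i - j)) = (\<Sum>i\<le>m. \<Sum>j\<le>m - i. ?u j (m - i - j) i)"
        unfolding sum_simplex_rotate[of "\<lambda>i j k. ?u j k i" m] ..
      have v: "(\<Sum>i\<le>m. \<Sum>j\<le>m - i. ?v i j (m - i - j)) = (\<Sum>i\<le>m. \<Sum>j\<le>m - i. ?v (m - i - j) i j)"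
        by (rule sum_simplex_rotate)
      show "coeff (loop_bracket br f (loop_bracket br g h) + loop_bracket br g (loop_bracket br h f) +
        loop_bracket br h (loop_bracket br f g)) m = coeff 0 m"
        using fgh L
        by (simp only: coeff_add coeff_loop_bracket_nested u v sum.distrib[symmetric] jacobi
            sum.neutral_const coeff_0)
    qed
    show "loop_bracket br f g \<in> poly_extension L"
      if "f \<in> poly_extension L" "g \<in> poly_extension L" for f g
      using that by (rule loop_bracket_in_poly_extension)
  qed (use L in
      \<open>auto simp: poly_eq_iff coeff_loop_bracket coeff_loop_scale br_add_left br_add_right
        br_scale_left br_scale_right sum.distrib scale_sum_right loop.subspace_add[OF sub]
        loop.subspace_scale[OF sub]\<close>)
qed

lemma loop_bracket_monom:
  assumes "u \<in> L" "v \<in> L"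
  shows "loop_bracket br (monom u i) (monom v j) = monom (br u v) (i + j)"
proof (rule poly_eqI)
  fix m
  have L: "monom u i \<in> poly_extension L" "monom v j \<in> poly_extension L"
    using assms subspace_0[OF subspace_L] by (auto simp: poly_extension_def)
  have "coeff (loop_bracket br (monom u i) (monom v j)) m =
      (\<Sum>k\<le>m. if k = i then if m = i + j then br u v else 0 else 0)"
    unfolding coeff_loop_bracket[OF L] using assms subspace_0[OF subspace_L]
    by (intro sum.cong) auto
  then show "coeff (loop_bracket br (monom u i) (monom v j)) m = coeff (monom (br u v) (i + j)) m"
    by auto
qed

end

section \<open>Loop algebras with the covering property\<close>

text \<open>
  A grading, given as a family over the integers, that has the covering property in all degrees. The loop algebra
  inherits this property, so that thinness becomes a matter of dimensions.
\<close>

locale covering_cyclic_grading = lie_algebra scale L br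
  for scale :: "'a::field \<Rightarrow> 'v::ab_group_add \<Rightarrow> 'v" and L br +
  fixes S :: "int \<Rightarrow> 'v set"
  assumes subspace_S: "subspace (S k)"
    and S_subset: "S k \<subseteq> L"
    and br_S: "x \<in> S i \<Longrightarrow> y \<in> S j \<Longrightarrow> br x y \<in> S (i + j)"
    and covering_S: "u \<in> S k \<Longrightarrow> u \<noteq> 0 \<Longrightarrow> S (k + 1) = br u ` S 1"
    and S_nonzero: "\<exists>u\<in>S k. u \<noteq> 0"
begin

text \<open>
  By the covering property a single nonzero \<open>u\<close> in degree \<open>k\<close> already produces all of degree \<open>k + 1\<close> by
  brackets with degree one. Hence any property of degree one that is stable under such brackets
  holds in all positive degrees, and the sets \<open>P k\<close> need not be subspaces.
\<close>

lemma S_ascend: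
  assumes "k \<ge> 1" and base: "S 1 \<subseteq> P 1"
    and step: "\<And>k u v. k \<ge> 1 \<Longrightarrow> u \<in> S (int k) \<Longrightarrow> u \<in> P k \<Longrightarrow> v \<in> S 1 \<Longrightarrow> br u v \<in> P (Suc k)"
  shows "S (int k) \<subseteq> P k"
  using \<open>k \<ge> 1\<close>
proof (induction k rule: nat_induct_at_least)
  case base
  then show ?case using assms(2) by simp
next
  case (Suc k)
  obtain u where u: "u \<in> S (int k)" "u \<noteq> 0" using S_nonzero by blast
  have "S (int (Suc k)) = br u ` S 1"
    using covering_S[OF u] by (simp add: add.commute)
  then show ?case using step[OF Suc.hyps u(1)] Suc.IH u(1) by auto
qed

abbreviation "lsc \<equiv> loop_scale scale"
abbreviation "lbr \<equiv> loop_bracket br"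
abbreviation "N \<equiv> loop_algebra scale L br S"

sublocale loop: lie_algebra lsc "poly_extension L" lbr
  by (rule lie_algebra_poly_extension)

lemma S_0: "0 \<in> S k"
  by (rule subspace_0[OF subspace_S])

lemma S_L: "u \<in> S k \<Longrightarrow> u \<in> L"
  using S_subset by blast

lemma loop_scale_monom: "lsc c (monom u k) = monom (scale c u) k"
  by (rule poly_eqI) (simp add: coeff_loop_scale)

lemma lie_subalgebra_graded_polys:
  "lie_subalgebra lsc (poly_extension L) lbr {f. coeff f 0 = 0 \<and> (\<forall>k. coeff f k \<in> S (int k))}"
    (is "lie_subalgebra _ _ _ ?N")
  unfolding lie_subalgebra_def
proof (intro conjI ballI)
  show sub: "?N \<subseteq> poly_extension L"
    using S_L by (auto simp: poly_extension_def)
  show "loop.subspace ?N"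
    using S_0 by (auto simp: loop.subspace_def coeff_loop_scale
        subspace_add[OF subspace_S] subspace_scale[OF subspace_S])
  fix f g assume fg: "f \<in> ?N" "g \<in> ?N"
  have "coeff (lbr f g) m \<in> S (int m)" for m
  proof -
    have "br (coeff f i) (coeff g (m - i)) \<in> S (int m)" if "i \<le> m" for i
    proof -
      have "br (coeff f i) (coeff g (m - i)) \<in> S (int i + int (m - i))" using fg br_S by simp
      moreover have "int i + int (m - i) = int m" using that by simp
      ultimately show ?thesis by metis
    qed
    then show ?thesis
      using fg sub by (subst coeff_loop_bracket) (auto intro!: subspace_sum[OF subspace_S])
  qed
  moreover have "coeff (lbr f g) 0 = 0"
    using fg sub by (subst coeff_loop_bracket) (auto intro!: br_zero_left S_L[OF S_0])
  ultimately show "lbr f g \<in> ?N" by simp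
qed

text \<open>
  The right-hand side is a subalgebra containing the generators. Conversely, \<open>S_ascend\<close> puts every
  \<open>u \<otimes> t\<^sup>k\<close> with \<open>u \<in> S k\<close>, \<open>k \<ge> 1\<close>, into every subalgebra that contains the generators.
\<close>

lemma loop_algebra_eq: "N = {f. coeff f 0 = 0 \<and> (\<forall>k. coeff f k \<in> S (int k))}" (is "_ = ?N")
proof
  note lie_subalgebra_graded_polys
  moreover have "(\<lambda>u. monom u 1) ` S 1 \<subseteq> ?N" using S_0 by auto
  ultimately show "N \<subseteq> ?N" by (auto simp: loop_algebra_def lie_generated_def)
  show "?N \<subseteq> N"
    unfolding loop_algebra_def lie_generated_def
  proof (intro subsetI InterI)
    fix f K assume f: "f \<in> ?N"
      and "K \<in> {K. lie_subalgebra lsc (poly_extension L) lbr K \<and> (\<lambda>u. monom u 1) ` S 1 \<subseteq> K}"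
    then have K: "loop.subspace K" "\<And>x y. x \<in> K \<Longrightarrow> y \<in> K \<Longrightarrow> lbr x y \<in> K"
      and base: "\<And>u. u \<in> S 1 \<Longrightarrow> monom u 1 \<in> K" by (auto simp: lie_subalgebra_def)
    have in_K: "S (int k) \<subseteq> {u. monom u k \<in> K}" if "k \<ge> 1" for k
      using that
    proof (rule S_ascend)
      show "S 1 \<subseteq> {u. monom u 1 \<in> K}" using base by auto
      show "br u v \<in> {w. monom w (Suc k) \<in> K}"
        if "u \<in> S (int k)" "u \<in> {w. monom w k \<in> K}" "v \<in> S 1" for k u v
        using K(2)[of "monom u k" "monom v 1"] base that by (simp add: loop_bracket_monom S_L)
    qed
    have "monom (coeff f k) k \<in> K" for k
    proof (cases "k = 0")
      case True
      then show ?thesis using f loop.subspace_0[OF K(1)] by simp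
    next
      case False
      then show ?thesis using f in_K[of k] by auto
    qed
    then have "(\<Sum>k\<le>degree f. monom (coeff f k) k) \<in> K"
      by (intro loop.subspace_sum[OF K(1)])
    then show "f \<in> K" by (simp add: poly_as_sum_of_monoms)
  qed
qed

lemma loop_component_eq:
  assumes "k \<ge> 1"
  shows "loop_component N k = (\<lambda>u. monom u k) ` S (int k)"
proof
  show "loop_component N k \<subseteq> (\<lambda>u. monom u k) ` S (int k)"
  proof
    fix f assume "f \<in> loop_component N k"
    then obtain u where f: "f = monom u k" "\<forall>i. coeff f i \<in> S (int i)"
      by (auto simp: loop_component_def loop_algebra_eq)
    then show "f \<in> (\<lambda>u. monom u k) ` S (int k)" using f(2)[rule_format, of k] by simp
  qed
  show "(\<lambda>u. monom u k) ` S (int k) \<subseteq> loop_component N k"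
    using assms S_0 by (auto simp: loop_component_def loop_algebra_eq)
qed

lemma lie_subalgebra_loop_algebra: "lie_subalgebra lsc (poly_extension L) lbr N"
  unfolding loop_algebra_eq by (rule lie_subalgebra_graded_polys)

lemma linear_monom: "Vector_Spaces.linear scale lsc (\<lambda>u. monom u k)"
  by unfold_locales (simp_all add: add_monom loop_scale_monom)

lemma subspace_loop_component: "k \<ge> 1 \<Longrightarrow> loop.subspace (loop_component N k)"
  unfolding loop_component_eq
  by (intro module_hom.subspace_image[OF Vector_Spaces.linear.axioms(3)[OF linear_monom]] subspace_S)

lemma lie_grading_loop_algebra: "lie_grading lsc N lbr {1..} (loop_component N)"
  unfolding lie_grading_def
proof (intro conjI ballI)
  show "lie_algebra lsc N lbr"
    by (rule lie_algebra_subalgebra[OF loop.lie_algebra_axioms lie_subalgebra_loop_algebra])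
  show "loop.subspace (loop_component N k)" if "k \<in> {1..}" for k
    using that subspace_loop_component by simp
  show "lbr x y \<in> loop_component N (i + j)"
    if ij: "i \<in> {1..}" "j \<in> {1..}" and xy: "x \<in> loop_component N i" "y \<in> loop_component N j" for i j x y
  proof -
    obtain u v where uv: "x = monom u i" "y = monom v j" "u \<in> S (int i)" "v \<in> S (int j)"
      using ij xy by (auto simp: loop_component_eq)
    then show ?thesis
      using ij br_S[of u "int i" v "int j"] by (auto simp: loop_component_eq loop_bracket_monom S_L)
  qed
  show "is_direct_sum {1..} (loop_component N) N"
    unfolding is_direct_sum_alt bij_betw_def
  proof
    let ?F = "direct_sum_families {1..} (loop_component N)"
    have comp: "f i \<in> N \<and> f i = monom (coeff (f i) i) i" if "f \<in> ?F" for f i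
    proof (cases "i \<ge> 1")
      case True
      then have "f i \<in> loop_component N i" using that by (simp add: direct_sum_families_def)
      then show ?thesis by (auto simp: loop_component_def)
    next
      case False
      then have "f i = 0" using that by (auto simp: direct_sum_families_def)
      then show ?thesis by (simp add: loop_algebra_eq S_0)
    qed
    have coeff: "coeff (\<Sum>k | f k \<noteq> 0. f k) i = coeff (f i) i" if f: "f \<in> ?F" for f i
    proof -
      have fin: "finite {k. f k \<noteq> 0}" using f by (simp add: direct_sum_families_def)
      have "coeff (\<Sum>k | f k \<noteq> 0. f k) i = (\<Sum>k | f k \<noteq> 0. if k = i then coeff (f k) k else 0)"
        unfolding coeff_sum by (intro sum.cong refl) (metis coeff_monom comp[OF f])
      also have "\<dots> = coeff (f i) i" using fin by (simp add: sum.delta)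
      finally show ?thesis .
    qed
    show "inj_on (\<lambda>f. \<Sum>i | f i \<noteq> 0. f i) ?F"
    proof (intro inj_onI ext)
      fix f g i assume fg: "f \<in> ?F" "g \<in> ?F" "(\<Sum>i | f i \<noteq> 0. f i) = (\<Sum>i | g i \<noteq> 0. g i)"
      then have "coeff (f i) i = coeff (g i) i" using coeff by metis
      then show "f i = g i" using comp fg by metis
    qed
    have "(\<Sum>k | f k \<noteq> 0. f k) \<in> N" if f: "f \<in> ?F" for f
      using comp[OF f] lie_subalgebra_loop_algebra
      by (auto simp: lie_subalgebra_def intro!: loop.subspace_sum)
    moreover have "h \<in> (\<lambda>f. \<Sum>i | f i \<noteq> 0. f i) ` ?F" if h: "h \<in> N" for h
    proof -
      define f where "f k = monom (coeff h k) k" for k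
      have supp: "{k. f k \<noteq> 0} \<subseteq> {..degree h}" by (auto simp: f_def intro: le_degree)
      have "f 0 = 0" "coeff h k \<in> S (int k)" for k
        using h by (simp_all add: f_def loop_algebra_eq)
      then have "f \<in> ?F"
        using finite_subset[OF supp]
        by (auto simp: direct_sum_families_def loop_component_eq f_def not_le Suc_le_eq)
      moreover have "(\<Sum>k | f k \<noteq> 0. f k) = (\<Sum>k\<le>degree h. f k)"
        using supp by (intro sum.mono_neutral_left) auto
      then have "(\<Sum>k | f k \<noteq> 0. f k) = h" by (simp add: f_def poly_as_sum_of_monoms)
      ultimately show ?thesis by (intro image_eqI[of _ _ f]) auto
    qed
    ultimately show "(\<lambda>f. \<Sum>i | f i \<noteq> 0. f i) ` ?F = N" by blast
  qed
qed

text \<open>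
  A finite set of polynomials spans only polynomials of bounded degree, while every degree of the loop algebra
  is nonzero.
\<close>

lemma loop_algebra_infinite_dimensional:
  assumes "finite B"
  shows "\<not> N \<subseteq> loop.span B"
proof
  assume sub: "N \<subseteq> loop.span B"
  have degree_lsc: "degree (lsc c f) \<le> degree f" for c f
    by (rule degree_le) (simp add: coeff_loop_scale coeff_eq_0)
  define d where "d = Max (insert 0 (degree ` B))"
  have "loop.subspace {f. degree f \<le> d}"
    using order_trans[OF degree_lsc] by (auto simp: loop.subspace_def intro: degree_add_le)
  moreover have "B \<subseteq> {f. degree f \<le> d}" using assms by (auto simp: d_def)
  ultimately have "loop.span B \<subseteq> {f. degree f \<le> d}" by (rule loop.span_minimal[rotated])
  moreover obtain u where u: "u \<in> S (int (Suc d))" "u \<noteq> 0" using S_nonzero by blast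
  then have "monom u (Suc d) \<in> N" using S_0 by (auto simp: loop_algebra_eq)
  ultimately have "degree (monom u (Suc d)) \<le> d" using sub by blast
  then show False using u by (simp add: degree_monom_eq)
qed

lemma dim_loop_component:
  assumes "k \<ge> 1" "independent B" "span B = S (int k)"
  shows "loop.dim (loop_component N k) = card B"
proof -
  interpret monom: Vector_Spaces.linear scale lsc "\<lambda>u. monom u k"
    by (rule linear_monom)
  have inj: "inj (\<lambda>u::'v. monom u k)" by (auto intro!: injI)
  have "loop.span ((\<lambda>u. monom u k) ` B) = loop_component N k"
    using assms by (simp add: monom.span_image loop_component_eq)
  moreover have "loop.independent ((\<lambda>u. monom u k) ` B)"
    by (rule monom.independent_inj_image[OF assms(2) inj])
  ultimately have "loop.dim (loop_component N k) = card ((\<lambda>u. monom u k) ` B)"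
    using loop.dim_span_eq_card_independent by metis
  then show ?thesis using inj by (metis card_image inj_on_subset subset_UNIV)
qed

lemma thin_loop_algebra:
  assumes "loop.dim (loop_component N 1) = 2" and "i > 1" "loop.dim (loop_component N i) = 2"
  shows "thin_lie_algebra lsc N lbr (loop_component N)"
  unfolding thin_lie_algebra_def
proof (intro conjI allI ballI impI)
  show "\<nexists>B. finite B \<and> N \<subseteq> loop.span B" using loop_algebra_infinite_dimensional by blast
  show "\<exists>i>1. i \<in> diamond_degrees lsc (loop_component N)"
    using assms(2,3) by (auto simp: diamond_degrees_def)
  fix i :: nat and x assume i: "i \<ge> 1" and x: "x \<in> loop_component N i" "x \<noteq> 0"
  then obtain u where u: "x = monom u i" "u \<in> S (int i)" "u \<noteq> 0" by (auto simp: loop_component_eq)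
  have "lbr x ` loop_component N 1 = (\<lambda>v. monom v (i + 1)) ` br u ` S 1"
    unfolding loop_component_eq[OF le_refl] of_nat_1 image_image
    using u by (intro image_cong) (auto simp: loop_bracket_monom S_L)
  also have "br u ` S 1 = S (int (i + 1))" using covering_S[OF u(2,3)] by (simp add: add.commute)
  finally show "loop_component N (i + 1) = lbr x ` loop_component N 1"
    by (simp only: loop_component_eq[of "i + 1"])
qed (use assms lie_grading_loop_algebra in auto)

end

section \<open>The graded basis\<close>

locale hamiltonian_roots =
  fixes \<sigma> \<rho> :: "'a::field" and p n q :: nat
  assumes char: "CHAR('a) = p" and odd_p: "odd p" and n_pos: "n > 0" and q_def: "q = p ^ n"
    and sigma_nonzero: "\<sigma> \<noteq> 0" and root: "\<rho> ^ p - \<sigma> ^ (p - 1) * \<rho> - 1 = 0"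
begin

lemma prime_p: "prime p"
  using prime_CHAR_semidom[where 'a='a] odd_pos[OF odd_p] char by simp

lemma p_ge_3: "p \<ge> 3"
  using prime_ge_2_nat[OF prime_p] odd_p by (cases "p = 2") auto

lemma q_ge_3: "q \<ge> 3"
  using p_ge_3 n_pos self_le_power[of p n] by (simp add: q_def)

lemma of_nat_p [simp]: "of_nat p = (0 :: 'a)"
  using of_nat_CHAR[where 'a='a] char by simp

lemma of_nat_q [simp]: "of_nat q = (0 :: 'a)"
  using n_pos by (simp add: q_def)

lemma of_nat_q_minus_1: "of_nat (q - 1) = (- 1 :: 'a)"
  using q_ge_3 by (simp add: of_nat_diff)

lemma frobenius_add: "(x + y :: 'a) ^ p = x ^ p + y ^ p"
  by (rule freshmans_dream) (simp_all add: char prime_p)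

lemma of_int_power_p: "(of_int c :: 'a) ^ p = of_int c"
proof -
  have nat: "(of_nat m :: 'a) ^ p = of_nat m" for m
  proof (induction m)
    case 0
    then show ?case using p_ge_3 by simp
  next
    case (Suc m)
    then show ?case
      using frobenius_add[of "of_nat m" 1] by (simp add: add.commute)
  qed
  show ?thesis
    by (cases c rule: int_cases2) (simp_all add: nat odd_p)
qed

text \<open>
  The relation \<open>\<alpha>\<^sup>p = \<sigma>\<^sup>p\<^sup>-\<^sup>1 \<alpha> + r\<close> for \<open>\<alpha> \<in> r \<rho> + F\<^sub>p \<sigma>\<close>, by additivity of the Frobenius map: \<open>\<sigma>\<close> is a root of
  \<open>T\<^sup>p - \<sigma>\<^sup>p\<^sup>-\<^sup>1 T\<close>, on which \<open>\<rho>\<close> takes the value \<open>1\<close>.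
\<close>

lemma root_power: "(of_int r * \<rho> + of_int s * \<sigma>) ^ p =
  \<sigma> ^ (p - 1) * (of_int r * \<rho> + of_int s * \<sigma>) + of_int r"
proof -
  have "\<sigma> ^ p = \<sigma> ^ (p - 1) * \<sigma>" using p_ge_3 by (simp flip: power_Suc2)
  moreover have "\<rho> ^ p = \<sigma> ^ (p - 1) * \<rho> + 1" using root by (simp add: algebra_simps)
  moreover have "(of_int r * \<rho> + of_int s * \<sigma>) ^ p = (of_int r * \<rho>) ^ p + (of_int s * \<sigma>) ^ p"
    by (rule frobenius_add)
  ultimately show ?thesis
    by (simp add: power_mult_distrib of_int_power_p algebra_simps)
qed

text \<open>
  Every scalar that must not vanish in the sequel has this form; in particular \<open>\<rho>\<close> and \<open>\<sigma>\<close> are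
  linearly independent over the prime field.
\<close>

lemma root_nonzero:
  assumes "(of_int r :: 'a) \<noteq> 0"
  shows "of_int r * \<rho> + of_int s * \<sigma> \<noteq> 0"
proof
  assume "of_int r * \<rho> + of_int s * \<sigma> = 0"
  then show False using root_power[of r s] assms p_ge_3 by (simp add: power_0_left)
qed

text \<open>
  Indexing by \<open>(j, s)\<close> with \<open>s\<close> an integer, instead of by \<open>(1 - j, \<alpha>)\<close>, makes the second label additive; it
  matters only modulo \<open>p\<close>.
\<close>

definition weight :: "nat \<Rightarrow> int \<Rightarrow> 'a" where
  "weight j s = of_int (1 - int j) * \<rho> + of_int s * \<sigma>"

definition g :: "nat \<Rightarrow> int \<Rightarrow> 'a dp" where
  "g j s = ham_e \<sigma> (1 - int j) (weight j s)"

definition H :: "'a dp set" where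
  "H = dp_space 1 n"

definition hbr :: "'a dp \<Rightarrow> 'a dp \<Rightarrow> 'a dp" where
  "hbr = ham_bracket 1 n"

sublocale lie_algebra dp_scale H hbr
  unfolding H_def hbr_def using lie_algebra_ham_bracket prime_p char by blast

lemma g_in_H: "j < q \<Longrightarrow> g j s \<in> H"
  unfolding g_def H_def using ham_e_in_dp_space prime_p char q_def by metis

lemma g_cong: "[s = t] (mod int p) \<Longrightarrow> g j s = g j t"
  using of_int_eq_iff_cong_CHAR[where 'a='a, of s t] char by (simp add: g_def weight_def)

lemma weight_power: "weight j s ^ p = \<sigma> ^ (p - 1) * weight j s + (1 - of_nat j)"
  unfolding weight_def by (subst root_power) simp

lemma hbr_g:
  assumes "j + l \<ge> 1"
  shows "hbr (g j s) (g l t) = (if j + l - 1 < q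
    then dp_scale (of_nat (shifted_choose j l) * weight l t - of_nat (shifted_choose l j) * weight j s)
      (g (j + l - 1) (s + t)) else 0)"
proof -
  have "weight j s + weight l t = weight (j + l - 1) (s + t)"
    using assms by (simp add: weight_def of_nat_diff algebra_simps)
  then show ?thesis
    using ham_bracket_ham_e[OF char prime_p odd_p weight_power weight_power, of n j s l t]
    by (simp add: g_def q_def hbr_def)
qed

lemma hbr_g_00: "hbr (g 0 s) (g 0 t) = 0"
  using ham_bracket_ham_e[OF char prime_p odd_p weight_power weight_power, of n 0 s 0 t]
  by (simp add: g_def hbr_def shifted_choose_def)

lemma hbr_g_Suc_0: "j < q \<Longrightarrow> hbr (g (Suc j) s) (g 0 t) = dp_scale (weight 0 t) (g j (s + t))"
  by (subst hbr_g) (auto simp: shifted_choose_def)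

lemma hbr_g_0_top: "hbr (g 0 s) (g (q - 1) t) = dp_scale (- weight 0 s) (g (q - 2) (s + t))"
  using q_ge_3 by (subst hbr_g) (auto simp: shifted_choose_def numeral_2_eq_2)

lemma hbr_g_1_top:
  "hbr (g 1 s) (g (q - 1) t) = dp_scale (2 * \<rho> + of_int (s + t) * \<sigma>) (g (q - 1) (s + t))"
proof -
  have "weight (q - 1) t + weight 1 s = 2 * \<rho> + of_int (s + t) * \<sigma>"
    using q_ge_3 by (simp add: weight_def of_nat_diff algebra_simps)
  then show ?thesis
    using q_ge_3 of_nat_q_minus_1 by (subst hbr_g) (auto simp: shifted_choose_def)
qed

lemma hbr_g_top_eq_0: "j \<ge> 2 \<Longrightarrow> hbr (g j s) (g (q - 1) t) = 0"
  using q_ge_3 by (subst hbr_g) auto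

text \<open>
  The coefficient of \<open>g j s\<close>. After the correction at \<open>x\<^sup>(\<^sup>p\<^sup>-\<^sup>1\<^sup>)\<close> has been removed, the coefficients of \<open>g j t\<close>
  are the powers of \<open>weight j t\<close>. Pairing them with the coefficients of a polynomial \<open>P\<close> of degree below \<open>p\<close>
  evaluates \<open>P\<close>, and \<open>1 - ((x - weight j s) / \<sigma>)\<^sup>p\<^sup>-\<^sup>1\<close> separates the weights by Fermat's little theorem.
\<close>

definition coord :: "nat \<Rightarrow> int \<Rightarrow> 'a dp \<Rightarrow> 'a" where
  "coord j s f = (let P = 1 - [:- weight j s / \<sigma>, 1 / \<sigma>:] ^ (p - 1) in
     \<Sum>i<p. coeff P i * (f i j - (if i = p - 1 then \<sigma> ^ (p - 1) * of_nat j * f 0 j else 0)))"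

lemma coord_add: "coord j s (f + h) = coord j s f + coord j s h"
  by (simp add: coord_def Let_def sum.distrib[symmetric] algebra_simps if_distrib cong: if_cong)

lemma coord_scale: "coord j s (dp_scale c f) = c * coord j s f"
  by (simp add: coord_def Let_def sum_distrib_left dp_scale_def algebra_simps if_distrib cong: if_cong)

lemma coord_g: "coord j s (g l t) = (if l = j \<and> [t = s] (mod int p) then 1 else 0)"
proof (cases "l = j")
  case False
  then show ?thesis
    using char p_ge_3 by (auto simp: coord_def g_def ham_e_eq_tensor dp_tensor_def intro!: sum.neutral)
next
  case True
  define P where "P = 1 - [:- weight j s / \<sigma>, 1 / \<sigma>:] ^ (p - 1)"
  have "degree ([:- weight j s / \<sigma>, 1 / \<sigma>:] ^ (p - 1)) \<le> p - 1"
    using degree_power_le[of "[:- weight j s / \<sigma>, 1 / \<sigma>:]" "p - 1"] by (simp split: if_splits)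
  then have deg: "degree P < p"
    using p_ge_3 degree_diff_le_max[of 1 "[:- weight j s / \<sigma>, 1 / \<sigma>:] ^ (p - 1)"]
    by (simp add: P_def)
  have "coord j s (g l t) = (\<Sum>i<p. coeff P i * weight j t ^ i)"
    unfolding coord_def Let_def P_def[symmetric] using True char p_ge_3
    by (intro sum.cong) (auto simp: g_def ham_e_eq_tensor dp_tensor_def ham_profile_def)
  also have "\<dots> = poly P (weight j t)"
    unfolding poly_altdef using deg by (intro sum.mono_neutral_right) (auto simp: coeff_eq_0)
  also have "\<dots> = 1 - of_int (t - s) ^ (p - 1)"
  proof -
    have "(weight j t - weight j s) / \<sigma> = of_int (t - s)"
      using sigma_nonzero by (simp add: weight_def field_simps)
    then show ?thesis by (simp add: P_def poly_power diff_divide_distrib)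
  qed
  also have "\<dots> = (if [t = s] (mod int p) then 1 else 0)"
  proof (cases "[t = s] (mod int p)")
    case c: True
    then have "of_int (t - s) = (0 :: 'a)"
      using of_int_eq_iff_cong_CHAR[where 'a='a, of t s] char by simp
    then show ?thesis using p_ge_3 c by (simp add: power_0_left)
  next
    case False
    then have nz: "of_int (t - s) \<noteq> (0 :: 'a)"
      using of_int_eq_iff_cong_CHAR[where 'a='a, of t s] char by simp
    have "of_int (t - s) ^ (p - 1) * of_int (t - s) = (of_int (t - s) :: 'a)"
      using of_int_power_p[of "t - s"] p_ge_3 by (metis Suc_diff_1 less_le_trans power_Suc2 zero_less_numeral)
    then show ?thesis using nz False by simp
  qed
  finally show ?thesis using True by simp
qed

lemma g_eq_iff: "g j s = g l t \<longleftrightarrow> j = l \<and> [s = t] (mod int p)"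
proof
  assume "g j s = g l t"
  then have "coord l t (g j s) = 1" by (simp add: coord_g)
  then show "j = l \<and> [s = t] (mod int p)" by (simp add: coord_g split: if_splits)
qed (auto intro: g_cong)

definition g_basis :: "'a dp set" where
  "g_basis = {g j s | j s. j < q}"

lemma independent_g_basis: "dp.independent g_basis"
proof (rule dp.independent_if_dual)
  fix b assume "b \<in> g_basis"
  then obtain j s where b: "b = g j s" by (auto simp: g_basis_def)
  have "coord j s b' = 0" if "b' \<in> g_basis - {b}" for b'
    using that b g_eq_iff by (auto simp: g_basis_def coord_g)
  moreover have "coord j s b \<noteq> 0" using b by (simp add: coord_g)
  ultimately show "\<exists>\<phi>. (\<forall>x y. \<phi> (x + y) = \<phi> x + \<phi> y) \<and> (\<forall>c x. \<phi> (dp_scale c x) = c * \<phi> x) \<and>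
      \<phi> b \<noteq> (0 :: 'a) \<and> (\<forall>b'\<in>g_basis - {b}. \<phi> b' = 0)"
    using coord_add coord_scale by (intro exI[of _ "coord j s"]) auto
qed

lemma g_basis_finite: "finite g_basis" and card_g_basis: "card g_basis = q * p"
proof -
  have *: "g_basis = (\<lambda>(j, s). g j s) ` ({..<q} \<times> {0..<int p})"
  proof -
    have "g j s = g j (s mod int p)" for j s by (intro g_cong) (simp add: cong_def)
    moreover have "s mod int p \<in> {0..<int p}" for s using p_ge_3 by simp
    ultimately have "g j s \<in> (\<lambda>(j, s). g j s) ` ({..<q} \<times> {0..<int p})" if "j < q" for j s
      using that by (intro image_eqI[of _ _ "(j, s mod int p)"]) auto
    then show ?thesis unfolding g_basis_def by auto
  qed
  then show "finite g_basis" by simp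
  have "inj_on (\<lambda>(j, s). g j s) ({..<q} \<times> {0..<int p})"
    by (auto simp: inj_on_def g_eq_iff cong_def)
  then show "card g_basis = q * p" unfolding * by (simp add: card_image)
qed

lemma dp_space_subset_span_monoms:
  "H \<subseteq> dp.span ((\<lambda>(i, j). dp_monom i j) ` ({..<p} \<times> {..<q}))"
proof
  fix f assume f: "f \<in> H"
  have "f = (\<Sum>(i, j)\<in>{..<p} \<times> {..<q}. dp_scale (f i j) (dp_monom i j))"
  proof (intro ext)
    fix i j
    have "(\<Sum>(i, j)\<in>{..<p} \<times> {..<q}. dp_scale (f i j) (dp_monom i j)) i j =
        (\<Sum>x\<in>{..<p} \<times> {..<q}. if x = (i, j) then f i j else 0)"
      unfolding sum_fun_apply by (intro sum.cong) (auto simp: dp_scale_def dp_monom_def split: if_splits)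
    also have "\<dots> = f i j" using f char q_def by (auto simp: H_def dp_space_def)
    finally show "f i j = (\<Sum>(i, j)\<in>{..<p} \<times> {..<q}. dp_scale (f i j) (dp_monom i j)) i j" ..
  qed
  also have "\<dots> \<in> dp.span ((\<lambda>(i, j). dp_monom i j) ` ({..<p} \<times> {..<q}))"
    by (intro dp.span_sum) (clarsimp, intro dp.span_scale dp.span_base, auto)
  finally show "f \<in> dp.span ((\<lambda>(i, j). dp_monom i j) ` ({..<p} \<times> {..<q}))" .
qed

text \<open>
  Counting: there are \<open>q p\<close> independent elements in a space spanned by as many monomials.
\<close>

lemma span_g_basis: "dp.span g_basis = H"
proof
  have B: "g_basis \<subseteq> H" using g_in_H by (auto simp: g_basis_def)
  then show "dp.span g_basis \<subseteq> H" by (intro dp.span_minimal subspace_L)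
  show "H \<subseteq> dp.span g_basis"
  proof (rule ccontr)
    assume "\<not> H \<subseteq> dp.span g_basis"
    then obtain h where h: "h \<in> H" "h \<notin> dp.span g_basis" by blast
    let ?M = "(\<lambda>(i, j). dp_monom i j) ` ({..<p} \<times> {..<q}) :: 'a dp set"
    have "dp.independent (insert h g_basis)"
      using dp.independent_insertI[OF h(2) independent_g_basis] .
    then have "card (insert h g_basis) \<le> card ?M"
      using dp.independent_span_bound[of ?M "insert h g_basis"] B h(1) dp_space_subset_span_monoms
      by (meson finite_SigmaI finite_imageI finite_lessThan insert_subset order_trans)
    also have "\<dots> \<le> p * q" using card_image_le[of "{..<p} \<times> {..<q}" "\<lambda>(i, j). dp_monom i j"] by simp
    also have "card (insert h g_basis) = Suc (q * p)"
      using h(2) dp.span_base g_basis_finite card_g_basis by (subst card_insert_disjoint) auto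
    finally show False by (simp add: mult.commute)
  qed
qed

text \<open>
  Degree \<open>k\<close> requires a second label congruent to \<open>k\<close> modulo \<open>p\<close>, and as this label matters only modulo \<open>p\<close>,
  one may take \<open>k\<close> itself.
\<close>

definition comp_basis :: "int \<Rightarrow> 'a dp set" where
  "comp_basis k = {g j k | j. j < q \<and> [k = 1 - int j] (mod (int q - 1))}"

definition component :: "int \<Rightarrow> 'a dp set" where
  "component k = dp.span (comp_basis k)"

definition M :: nat where
  "M = (q - 1) * p"

lemma int_M: "int M = (int q - 1) * int p"
  using q_ge_3 by (simp add: M_def of_nat_diff)

lemma M_gt_1: "M > 1"
proof -
  have "2 * 3 \<le> (q - 1) * p" using q_ge_3 p_ge_3 by (intro mult_le_mono) simp_all
  then show ?thesis by (simp add: M_def)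
qed

lemma coprime_q_minus_1_p: "coprime (int q - 1) (int p)"
proof -
  have "int p dvd int q" using n_pos by (simp add: q_def)
  then show ?thesis using coprime_divisors[OF dvd_refl _ coprime_diff_one_left] by blast
qed

lemma crt: "\<exists>k. [k = a] (mod (int q - 1)) \<and> [k = b] (mod int p)"
  using binary_chinese_remainder_int[OF coprime_q_minus_1_p] by blast

lemma cong_M_iff: "[k = l] (mod int M) \<longleftrightarrow> [k = l] (mod (int q - 1)) \<and> [k = l] (mod int p)"
  unfolding int_M using coprime_cong_mult coprime_q_minus_1_p cong_modulus_mult cong_dvd_modulus
  by (metis dvd_triv_right)

lemma comp_basis_cong: "[k = l] (mod int M) \<Longrightarrow> comp_basis k = comp_basis l"
  unfolding comp_basis_def cong_M_iff by (metis (no_types, lifting) cong_sym cong_trans g_cong)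

lemma component_cong: "[k = l] (mod int M) \<Longrightarrow> component k = component l"
  unfolding component_def using comp_basis_cong by metis

lemma comp_basis_subset: "comp_basis k \<subseteq> g_basis"
  by (auto simp: comp_basis_def g_basis_def)

lemma component_subset: "component k \<subseteq> H"
  unfolding component_def span_g_basis[symmetric] by (rule dp.span_mono[OF comp_basis_subset])

lemma subspace_component: "dp.subspace (component k)"
  by (simp add: component_def)

lemma independent_comp_basis: "dp.independent (comp_basis k)"
  by (rule dp.independent_mono[OF independent_g_basis comp_basis_subset])

lemma g_in_component_iff:
  assumes "j < q"
  shows "g j s \<in> component k \<longleftrightarrow> [k = 1 - int j] (mod (int q - 1)) \<and> [k = s] (mod int p)"
proof
  assume "[k = 1 - int j] (mod (int q - 1)) \<and> [k = s] (mod int p)"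
  then have "g j s \<in> comp_basis k"
    using assms g_eq_iff[of j s j k] by (auto simp: comp_basis_def cong_sym)
  then show "g j s \<in> component k" by (simp add: component_def dp.span_base)
next
  assume gk: "g j s \<in> component k"
  have "g j s \<in> comp_basis k"
  proof (rule ccontr)
    assume "g j s \<notin> comp_basis k"
    then have "comp_basis k \<subseteq> g_basis - {g j s}" using comp_basis_subset by blast
    then have "g j s \<in> dp.span (g_basis - {g j s})"
      using gk dp.span_mono unfolding component_def by blast
    moreover have "g j s \<in> g_basis" using assms by (auto simp: g_basis_def)
    ultimately show False using independent_g_basis by (auto simp: dp.dependent_def)
  qed
  then show "[k = 1 - int j] (mod (int q - 1)) \<and> [k = s] (mod int p)"
    by (auto simp: comp_basis_def g_eq_iff cong_sym)
qed

text \<open>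
  Among the \<open>q\<close> values of \<open>j\<close> only \<open>0\<close> and \<open>q - 1\<close> are congruent modulo \<open>q - 1\<close>. This is the reason why there are
  diamonds, and why they occur only in the degrees congruent to \<open>1\<close>.
\<close>

lemma residue_index:
  assumes "[k = 1 - int i] (mod (int q - 1))" "[k = 1 - int j] (mod (int q - 1))" "i < q" "j < q"
  shows "i = j \<or> {i, j} = {0, q - 1}"
proof -
  have "[1 - int i = 1 - int j] (mod (int q - 1))"
    using assms(1,2) by (metis cong_sym cong_trans)
  then have "int q - 1 dvd int j - int i" by (simp add: cong_iff_dvd_diff)
  then obtain c where c: "int j - int i = (int q - 1) * c" by blast
  have "\<bar>int j - int i\<bar> \<le> int q - 1" using assms(3,4) by linarith
  then have "(int q - 1) * \<bar>c\<bar> \<le> (int q - 1) * 1" using c q_ge_3 by (simp add: abs_mult)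
  moreover have "int q - 1 > 0" using q_ge_3 by simp
  ultimately have "\<bar>c\<bar> \<le> 1" by (simp only: mult_le_cancel_left_pos)
  then consider "c = 0" | "c = 1" | "c = -1" by linarith
  then show ?thesis
  proof cases
    case 2
    then have "j = q - 1" "i = 0" using c assms(3,4) by auto
    then show ?thesis by simp
  next
    case 3
    then have "i = q - 1" "j = 0" using c assms(3,4) by auto
    then show ?thesis by auto
  qed (use c in auto)
qed

lemma comp_basis_diamond:
  assumes "[k = 1] (mod (int q - 1))"
  shows "comp_basis k = {g 0 k, g (q - 1) k}"
proof -
  have k0: "[k = 1 - int 0] (mod (int q - 1))" using assms by simp
  have "[1 = 1 - int (q - 1)] (mod (int q - 1))"
    using q_ge_3 by (simp add: cong_iff_dvd_diff of_nat_diff)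
  then have "[k = 1 - int (q - 1)] (mod (int q - 1))" using assms by (metis cong_trans)
  moreover have "j = 0 \<or> j = q - 1" if "[k = 1 - int j] (mod (int q - 1))" "j < q" for j
    using residue_index[OF that(1) k0 that(2)] q_ge_3 by (auto simp: doubleton_eq_iff)
  ultimately have "j < q \<and> [k = 1 - int j] (mod (int q - 1)) \<longleftrightarrow> j = 0 \<or> j = q - 1" for j
    using k0 q_ge_3 by auto
  then show ?thesis unfolding comp_basis_def by auto
qed

lemma comp_basis_single:
  assumes "[k = 1 - int j] (mod (int q - 1))" "0 < j" "j < q - 1"
  shows "comp_basis k = {g j k}"
proof -
  have "i = j" if "[k = 1 - int i] (mod (int q - 1))" "i < q" for i
    using residue_index[OF that(1) assms(1) that(2)] assms q_ge_3 by (auto simp: doubleton_eq_iff)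
  moreover have "j < q" using assms(3) by simp
  ultimately have "i < q \<and> [k = 1 - int i] (mod (int q - 1)) \<longleftrightarrow> i = j" for i
    using assms(1) by blast
  then show ?thesis unfolding comp_basis_def by auto
qed

lemma degree_cases:
  obtains (diamond) "[k = 1] (mod (int q - 1))"
  | (single) j where "[k = 1 - int j] (mod (int q - 1))" "0 < j" "j < q - 1"
proof -
  define j where "j = nat ((1 - k) mod (int q - 1))"
  have q1: "int q - 1 > 0" using q_ge_3 by simp
  then have ij: "int j = (1 - k) mod (int q - 1)" by (simp add: j_def)
  then have "[int j = 1 - k] (mod (int q - 1))" by (simp add: cong_def)
  then have k: "[k = 1 - int j] (mod (int q - 1))"
    by (simp add: cong_iff_dvd_diff algebra_simps)
  have "int j < int q - 1" using ij q1 by simp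
  then have "j < q - 1" by linarith
  then show ?thesis using k diamond single by (cases "j = 0") auto
qed

lemma card_comp_basis: "card (comp_basis k) = (if [k = 1] (mod (int q - 1)) then 2 else 1)"
proof (cases k rule: degree_cases)
  case diamond
  have "g 0 k \<noteq> g (q - 1) k" using q_ge_3 by (simp add: g_eq_iff)
  then show ?thesis using diamond by (simp add: comp_basis_diamond)
next
  case (single j)
  have "\<not> [k = 1] (mod (int q - 1))"
  proof
    assume "[k = 1] (mod (int q - 1))"
    then have "[k = 1 - int 0] (mod (int q - 1))" by simp
    moreover have "0 < q" "j < q" using single q_ge_3 by auto
    ultimately show False
      using residue_index[OF _ single(1), of 0] single(2,3) q_ge_3
      by (auto simp: doubleton_eq_iff)
  qed
  then show ?thesis using single by (simp add: comp_basis_single)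
qed

lemma comp_basis_nonempty: "comp_basis k \<noteq> {}"
  using card_comp_basis[of k] by (metis card.empty numeral_eq_one_iff semiring_norm(85) zero_neq_numeral zero_neq_one)

lemma hbr_component:
  assumes "x \<in> component i" "y \<in> component j"
  shows "hbr x y \<in> component (i + j)"
proof (rule br_span_closed[OF _ _ subspace_component _ assms[unfolded component_def]])
  show "comp_basis i \<subseteq> H" "comp_basis j \<subseteq> H"
    using g_in_H by (auto simp: comp_basis_def)
  fix x y assume "x \<in> comp_basis i" "y \<in> comp_basis j"
  then obtain a b where x: "x = g a i" "[i = 1 - int a] (mod (int q - 1))"
    and y: "y = g b j" "[j = 1 - int b] (mod (int q - 1))" by (auto simp: comp_basis_def)
  show "hbr x y \<in> component (i + j)"
  proof (cases "a + b \<ge> 1")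
    case True
    have "[i + j = (1 - int a) + (1 - int b)] (mod (int q - 1))"
      using x y by (intro cong_add)
    then have "[i + j = 1 - int (a + b - 1)] (mod (int q - 1))"
      using True by (simp add: of_nat_diff algebra_simps)
    then have "g (a + b - 1) (i + j) \<in> component (i + j)" if "a + b - 1 < q"
      using that by (simp add: g_in_component_iff)
    then show ?thesis
      using True x y by (simp add: hbr_g dp.subspace_0[OF subspace_component] dp.subspace_scale[OF subspace_component])
  next
    case False
    then have "a = 0" "b = 0" by auto
    then show ?thesis using x y hbr_g_00 dp.subspace_0[OF subspace_component] by simp
  qed
qed

section \<open>Generation and the covering property\<close>

abbreviation "X \<equiv> g 0 1"
abbreviation "Y \<equiv> g (q - 1) 1"

lemma X_Y_in_H: "X \<in> H" "Y \<in> H"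
  using g_in_H q_ge_3 by auto

lemma component_1: "component 1 = dp.span {X, Y}"
  by (simp add: component_def comp_basis_diamond)

lemma weight_0_nonzero: "weight 0 s \<noteq> 0"
  using root_nonzero[of 1 s] by (simp add: weight_def)

lemma double_root_nonzero: "2 * \<rho> + of_int s * \<sigma> \<noteq> 0"
proof -
  have "\<not> p dvd 2" using p_ge_3 by (auto dest: dvd_imp_le)
  then have "of_int 2 \<noteq> (0 :: 'a)" using of_nat_eq_0_iff_char_dvd[where 'a='a, of 2] char by simp
  then show ?thesis using root_nonzero[of 2 s] by simp
qed

lemma hbr_component_1: "u \<in> H \<Longrightarrow> hbr u ` component 1 = dp.span {hbr u X, hbr u Y}"
  unfolding component_1 using X_Y_in_H by (intro br_image_span_pair)

text \<open>
  In a diamond both \<open>X\<close> and \<open>Y\<close> lead to the same line, each with a nonzero scalar on one of the two basis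
  elements, so no nonzero vector is killed by both. Just below a diamond \<open>X\<close> leads to one of its basis elements
  and \<open>Y\<close> to the other. Elsewhere \<open>Y\<close> acts as zero and \<open>X\<close> is injective.
\<close>

lemma component_covering:
  assumes "u \<in> component k" "u \<noteq> 0"
  shows "component (k + 1) = hbr u ` component 1"
proof -
  have u: "u \<in> H" using assms component_subset by blast
  show ?thesis
  proof (cases k rule: degree_cases)
    case diamond
    obtain a b where ab: "u = dp_scale a (g 0 k) + dp_scale b (g (q - 1) k)"
      using assms(1) diamond by (auto simp: component_def comp_basis_diamond dp.span_pair)
    have gH: "g 0 k \<in> H" "g (q - 1) k \<in> H" using g_in_H q_ge_3 by auto
    note scale = dp.subspace_scale[OF subspace_L]
    let ?E = "g (q - 2) (k + 1)"
    have q2: "q - 1 = Suc (q - 2)" using q_ge_3 by simp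
    have hX: "hbr u X = dp_scale (b * weight 0 1) ?E"
      using hbr_g_Suc_0[of "q - 2" k 1] q_ge_3 X_Y_in_H gH scale
      by (simp add: ab br_add_left br_scale_left hbr_g_00 q2[symmetric] del: One_nat_def)
    have hY: "hbr u Y = dp_scale (- a * weight 0 k) ?E"
      using hbr_g_0_top[of k 1] hbr_g_top_eq_0[of "q - 1" k 1] q_ge_3 X_Y_in_H gH scale
      by (simp add: ab br_add_left br_scale_left del: One_nat_def)
    have nz: "b * weight 0 1 \<noteq> 0 \<or> - a * weight 0 k \<noteq> 0"
      using assms(2) ab weight_0_nonzero by auto
    have E: "comp_basis (k + 1) = {?E}"
    proof (rule comp_basis_single)
      have "int q - 1 dvd (k - 1) + (int q - 1)"
        using diamond by (simp only: cong_iff_dvd_diff dvd_add_triv_right_iff)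
      also have "(k - 1) + (int q - 1) = (k + 1) - (1 - int (q - 2))"
        using q_ge_3 by (simp add: of_nat_diff)
      finally show "[k + 1 = 1 - int (q - 2)] (mod (int q - 1))"
        by (simp only: cong_iff_dvd_diff)
    qed (use q_ge_3 in auto)
    show ?thesis
      unfolding hbr_component_1[OF u] hX hY dp.span_pair_multiples[OF nz]
      by (simp add: component_def E)
  next
    case (single j)
    obtain a where a: "u = dp_scale a (g j k)"
      using assms(1) single by (auto simp: component_def comp_basis_single dp.span_singleton)
    have gH: "g j k \<in> H" using g_in_H single by auto
    have a0: "a \<noteq> 0" using a assms(2) by auto
    obtain i where i: "j = Suc i" using single(2) by (metis gr0_implies_Suc)
    have k1: "[k + 1 = 1 - int i] (mod (int q - 1))"
      using cong_add[OF single(1), of 1 1] by (simp add: i algebra_simps)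
    have uX: "hbr u X = dp_scale (a * weight 0 1) (g i (k + 1))"
      using single X_Y_in_H gH hbr_g_Suc_0[of i k 1] by (simp add: a br_scale_left i)
    show ?thesis
    proof (cases "i = 0")
      case True
      have "hbr u Y = dp_scale (a * (2 * \<rho> + of_int (k + 1) * \<sigma>)) (g (q - 1) (k + 1))"
        using X_Y_in_H gH hbr_g_1_top[of k 1] True i by (simp add: a br_scale_left)
      then show ?thesis
        unfolding hbr_component_1[OF u] uX using True k1 a0 weight_0_nonzero double_root_nonzero
        by (simp add: dp.span_pair_scale component_def comp_basis_diamond del: of_int_add)
    next
      case False
      have uY: "hbr u Y = dp_scale 0 (g i (k + 1))"
        using X_Y_in_H gH hbr_g_top_eq_0[of j k 1] False i by (simp add: a br_scale_left)
      have nz: "a * weight 0 1 \<noteq> 0 \<or> (0 :: 'a) \<noteq> 0" using a0 weight_0_nonzero by simp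
      have "comp_basis (k + 1) = {g i (k + 1)}"
        using False single i by (intro comp_basis_single[OF k1]) auto
      then show ?thesis
        unfolding hbr_component_1[OF u] uX uY dp.span_pair_multiples[OF nz]
        by (simp add: component_def)
    qed
  qed
qed

sublocale covering_cyclic_grading dp_scale H hbr component
proof
  show "\<exists>u\<in>component k. u \<noteq> 0" for k
  proof -
    obtain u where u: "u \<in> comp_basis k" using comp_basis_nonempty by blast
    then have "u \<noteq> 0" using independent_comp_basis dp.dependent_zero by blast
    then show ?thesis using u dp.span_base unfolding component_def by blast
  qed
qed (use subspace_component component_subset hbr_component component_covering in auto)

text \<open>
  The positive multiple of the period added to the solution of the congruences brings the degree into the range
  that can be reached from degree one.
\<close>

lemma g_in_some_component: "j < q \<Longrightarrow> \<exists>k\<ge>1. g j s \<in> component (int k)"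
proof -
  assume j: "j < q"
  obtain k where k: "[k = 1 - int j] (mod (int q - 1))" "[k = s] (mod int p)" using crt by blast
  have M: "int M > 0" using M_gt_1 by simp
  define l where "l = nat (k mod int M) + M"
  have "[int l = k] (mod int M)" using M by (simp add: l_def cong_def)
  then have "g j s \<in> component (int l)"
    using j k g_in_component_iff component_cong by metis
  moreover have "l \<ge> 1" using M by (simp add: l_def)
  ultimately show ?thesis by blast
qed

lemma lie_generated_X_Y: "lie_generated dp_scale H hbr {X, Y} = H"
proof
  have "lie_subalgebra dp_scale H hbr H"
    using br_closed subspace_L by (auto simp: lie_subalgebra_def)
  then show "lie_generated dp_scale H hbr {X, Y} \<subseteq> H"
    using X_Y_in_H by (auto simp: lie_generated_def)
  show "H \<subseteq> lie_generated dp_scale H hbr {X, Y}"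
    unfolding lie_generated_def
  proof (intro Inter_greatest)
    fix K assume "K \<in> {K. lie_subalgebra dp_scale H hbr K \<and> {X, Y} \<subseteq> K}"
    then have K: "dp.subspace K" "\<And>x y. x \<in> K \<Longrightarrow> y \<in> K \<Longrightarrow> hbr x y \<in> K" "{X, Y} \<subseteq> K"
      by (auto simp: lie_subalgebra_def)
    have 1: "component 1 \<subseteq> K" unfolding component_1 using K by (intro dp.span_minimal)
    have "component (int k) \<subseteq> K" if "k \<ge> 1" for k
      using that 1 by (rule S_ascend) (use K 1 in auto)
    then have "g_basis \<subseteq> K" using g_in_some_component by (fastforce simp: g_basis_def)
    then show "H \<subseteq> K" unfolding span_g_basis[symmetric] using K by (intro dp.span_minimal)
  qed
qed

lemma cyclic_lie_grading_component: "cyclic_lie_grading dp_scale H hbr M component"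
  unfolding cyclic_lie_grading_def lie_grading_def
proof (intro conjI ballI allI)
  show "lie_algebra dp_scale H hbr" by (rule lie_algebra_axioms)
  show "component (k + int M) = component k" for k by (rule component_cong) (simp add: cong_def)
  have M: "int M > 0" using M_gt_1 by simp
  have cover: "g_basis = (\<Union>k\<in>{0..<int M}. comp_basis k)"
  proof
    show "g_basis \<subseteq> (\<Union>k\<in>{0..<int M}. comp_basis k)"
    proof
      fix b assume "b \<in> g_basis"
      then obtain j s where b: "b = g j s" "j < q" by (auto simp: g_basis_def)
      obtain k where k: "[k = 1 - int j] (mod (int q - 1))" "[k = s] (mod int p)" using crt by blast
      then have "b \<in> comp_basis k"
        using b g_eq_iff[of j s j k] by (auto simp: comp_basis_def cong_sym)
      moreover have "comp_basis k = comp_basis (k mod int M)"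
        by (rule comp_basis_cong) (simp add: cong_def)
      moreover have "k mod int M \<in> {0..<int M}" using M by simp
      ultimately show "b \<in> (\<Union>k\<in>{0..<int M}. comp_basis k)" by blast
    qed
  qed (use comp_basis_subset in blast)
  have disj: "comp_basis i \<inter> comp_basis k = {}"
    if "i \<in> {0..<int M}" "k \<in> {0..<int M}" "i \<noteq> k" for i k
  proof (rule ccontr)
    assume "comp_basis i \<inter> comp_basis k \<noteq> {}"
    then obtain j l where "g j i = g l k" "[i = 1 - int j] (mod (int q - 1))"
      "[k = 1 - int l] (mod (int q - 1))" by (auto simp: comp_basis_def)
    then have "[i = k] (mod int M)" unfolding cong_M_iff g_eq_iff by (metis cong_sym cong_trans)
    then show False using that by (auto simp: cong_def)
  qed
  show "is_direct_sum {0..<int M} component H"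
    using dp.is_direct_sum_span_partition[OF independent_g_basis cover disj]
    by (simp add: span_g_basis component_def[abs_def])
qed (use subspace_component hbr_component in auto)

text \<open>
  A grading is indexed by one residue system, but its bracket rule extends to all integers by periodicity. With
  \<open>S_ascend\<close> the components found here are contained in those of any other grading with \<open>X\<close> and \<open>Y\<close> in degree
  one, and nested decompositions are equal.
\<close>

lemma cyclic_lie_grading_unique:
  assumes S': "cyclic_lie_grading dp_scale H hbr M S'" and XY: "X \<in> S' 1" "Y \<in> S' 1"
  shows "S' = component"
proof
  note M = M_gt_1
  have period: "S' k = S' (k mod int M)" for k
  proof -
    have S'M: "S' (k + int M) = S' k" for k using S' by (simp add: cyclic_lie_grading_def)
    have up: "S' (k + int m * int M) = S' k" for k m
    proof (induction m)
      case (Suc m)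
      then show ?case using S'M[of "k + int m * int M"] by (simp add: algebra_simps)
    qed simp
    define c where "c = k div int M"
    have "k = k mod int M + c * int M" by (simp add: c_def)
    then show ?thesis
      using up[of "k mod int M" "nat c"] up[of k "nat (- c)"]
      by (cases "c \<ge> 0") (simp_all, metis add_diff_cancel_right' diff_minus_eq_add minus_mult_left add_uminus_conv_diff)
  qed
  have grading: "dp.subspace (S' i)" "x \<in> S' i \<Longrightarrow> y \<in> S' j \<Longrightarrow> hbr x y \<in> S' (i + j)"
    if "i \<in> {0..<int M}" "j \<in> {0..<int M}" for i j x y
    using S' that by (auto simp: cyclic_lie_grading_def lie_grading_def)
  have M_range: "k mod int M \<in> {0..<int M}" for k using M by simp
  have hbr_S': "hbr x y \<in> S' (i + j)" if "x \<in> S' i" "y \<in> S' j" for x y i j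
    using grading(2)[OF M_range[of i] M_range[of j]] that period[of i] period[of j]
      period[of "i mod int M + j mod int M"] period[of "i + j"] by (simp add: mod_add_eq)
  have sub1: "component 1 \<subseteq> S' 1"
    unfolding component_1 using XY grading(1)[of 1 1] M by (intro dp.span_minimal) auto
  have pos: "component (int k) \<subseteq> S' (int k)" if "k \<ge> 1" for k
    using that
  proof (rule S_ascend)
    show "hbr u v \<in> S' (int (Suc k))" if "u \<in> S' (int k)" "v \<in> component 1" for k u v
      using hbr_S'[of u "int k" v 1] that sub1 by (auto simp: add.commute)
  qed (use sub1 in simp)
  have sub: "component k \<subseteq> S' k" if "k \<in> {0..<int M}" for k
  proof -
    have "nat (k + int M) \<ge> 1" "int (nat (k + int M)) = k + int M" using that M by auto
    then have "component (k + int M) \<subseteq> S' (k + int M)" using pos by metis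
    then show ?thesis
      using cyclic_lie_grading_component S' by (simp add: cyclic_lie_grading_def)
  qed
  fix k
  have "component (k mod int M) = S' (k mod int M)"
  proof (rule direct_sum_components_eq[OF _ _ sub])
    show "is_direct_sum {0..<int M} component H" "is_direct_sum {0..<int M} S' H"
      using cyclic_lie_grading_component S' by (auto simp: cyclic_lie_grading_def lie_grading_def)
  qed (use grading(1) dp.subspace_0 M_range in auto)
  moreover have "component (k mod int M) = component k" by (rule component_cong) (simp add: cong_def)
  ultimately show "S' k = component k" using period by simp
qed

section \<open>Diamonds and their types\<close>

lemma dim_loop_component:
  "k \<ge> 1 \<Longrightarrow> loop.dim (loop_component N k) = (if [int k = 1] (mod (int q - 1)) then 2 else 1)"
  using dim_loop_component[OF _ independent_comp_basis, of k "int k"] card_comp_basis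
  by (simp add: component_def)

lemma diamond_degrees_loop: "diamond_degrees lsc (loop_component N) = {i. i \<ge> 1 \<and> [i = 1] (mod (q - 1))}"
proof -
  have "int (q - 1) = int q - 1" using q_ge_3 by (simp add: of_nat_diff)
  then have "[int k = 1] (mod (int q - 1)) \<longleftrightarrow> [k = 1] (mod (q - 1))" for k
    using cong_int_iff[of k 1 "q - 1"] by (metis of_nat_1)
  then have "loop.dim (loop_component N k) = 2 \<longleftrightarrow> [k = 1] (mod (q - 1))" if "k \<ge> 1" for k
    unfolding dim_loop_component[OF that] by presburger
  then show ?thesis unfolding diamond_degrees_def by blast
qed

lemma thin_loop: "thin_lie_algebra lsc N lbr (loop_component N)"
proof (rule thin_loop_algebra)
  show "q > 1" using q_ge_3 by simp
  have "[int q = 1] (mod (int q - 1))" by (simp add: cong_iff_dvd_diff)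
  then show "loop.dim (loop_component N q) = 2" using q_ge_3 by (simp add: dim_loop_component)
qed (simp add: dim_loop_component)

lemma second_diamond_degree_loop: "second_diamond_degree lsc (loop_component N) q"
  unfolding second_diamond_degree_def diamond_degrees_loop
proof (intro conjI ballI impI)
  show "q > 1" using q_ge_3 by simp
  show "q \<in> {i. i \<ge> 1 \<and> [i = 1] (mod (q - 1))}"
    using q_ge_3 by (simp add: cong_altdef_nat)
  fix i assume i: "i \<in> {i. i \<ge> 1 \<and> [i = 1] (mod (q - 1))}" "i > 1"
  then have "q - 1 dvd i - 1" by (simp add: cong_altdef_nat)
  then have "q - 1 \<le> i - 1" using i by (intro dvd_imp_le) auto
  then show "q \<le> i" using i by simp
qed

text \<open>
  The element \<open>g 1 k\<close> spans the line just below a diamond when \<open>k\<close> is a multiple of \<open>q - 1\<close>.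
\<close>

lemma brackets_below_diamond:
  fixes k :: int
  defines "E \<equiv> g (q - 2) (k + 2)"
  shows "hbr (hbr (g 1 k) X) X = 0" "hbr (hbr (g 1 k) Y) Y = 0"
    "hbr (hbr (g 1 k) X) Y = dp_scale (- ((\<rho> + \<sigma>) * (\<rho> + of_int (k + 1) * \<sigma>))) E"
    "hbr (hbr (g 1 k) Y) X = dp_scale ((\<rho> + \<sigma>) * (2 * \<rho> + of_int (k + 1) * \<sigma>)) E"
proof -
  have gH: "g 0 s \<in> H" "g (q - 1) s \<in> H" for s using g_in_H q_ge_3 by auto
  have q2: "q - 1 = Suc (q - 2)" using q_ge_3 by simp
  have w: "weight 0 (k + 1) = \<rho> + of_int (k + 1) * \<sigma>" by (simp add: weight_def)
  have kX: "hbr (g 1 k) X = dp_scale (\<rho> + \<sigma>) (g 0 (k + 1))"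
    using hbr_g_Suc_0[of 0 k 1] q_ge_3 by (simp add: weight_def)
  have kY: "hbr (g 1 k) Y = dp_scale (2 * \<rho> + of_int (k + 1) * \<sigma>) (g (q - 1) (k + 1))"
    by (rule hbr_g_1_top)
  show "hbr (hbr (g 1 k) X) X = 0" unfolding kX using gH by (simp add: br_scale_left hbr_g_00)
  show "hbr (hbr (g 1 k) Y) Y = 0"
    unfolding kY using gH hbr_g_top_eq_0[of "q - 1" "k + 1" 1] q_ge_3 by (simp add: br_scale_left)
  show "hbr (hbr (g 1 k) X) Y = dp_scale (- ((\<rho> + \<sigma>) * (\<rho> + of_int (k + 1) * \<sigma>))) E"
    unfolding kX br_scale_left[OF gH(1) X_Y_in_H(2)] hbr_g_0_top w dp.scale_scale
      mult_minus_right E_def by (simp only: add.assoc one_add_one)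
  show "hbr (hbr (g 1 k) Y) X = dp_scale ((\<rho> + \<sigma>) * (2 * \<rho> + of_int (k + 1) * \<sigma>)) E"
    unfolding kY using gH hbr_g_Suc_0[of "q - 2" "k + 1" 1] q_ge_3
    by (simp add: br_scale_left E_def weight_def add.assoc q2[symmetric] mult.commute del: One_nat_def)
qed

text \<open>
  Since \<open>q = 0\<close> in the field, the degree \<open>k + 1 = (m + 1) (q - 1) + 1\<close> of the diamond is \<open>- m\<close> there.
\<close>

lemma loop_brackets_below_diamond:
  fixes m :: nat
  defines "k \<equiv> (m + 1) * (q - 1)"
  assumes v: "v \<in> loop_component N k"
  obtains E c where
    "lbr (lbr v (monom X 1)) (monom X 1) = 0" "lbr (lbr v (monom Y 1)) (monom Y 1) = 0"
    "lbr (lbr v (monom X 1)) (monom Y 1) = lsc (- c * (\<rho> - of_nat m * \<sigma>)) E"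
    "lbr (lbr v (monom Y 1)) (monom X 1) = lsc (c * (2 * \<rho> - of_nat m * \<sigma>)) E"
proof -
  have k: "k \<ge> 1" using q_ge_3 by (simp add: k_def)
  have intk: "int k = int (m + 1) * (int q - 1)"
    using q_ge_3 unfolding k_def of_nat_mult by (simp add: of_nat_diff)
  have "[int k = 1 - int 1] (mod (int q - 1))" by (simp add: cong_iff_dvd_diff intk)
  then have "comp_basis (int k) = {g 1 (int k)}" using q_ge_3 by (intro comp_basis_single) auto
  then obtain a where a: "v = monom (dp_scale a (g 1 (int k))) k"
    using v k by (auto simp: loop_component_eq component_def dp.span_singleton)
  have field: "of_int (int k + 1) = (- of_nat m :: 'a)"
    unfolding intk by (simp add: algebra_simps)
  let ?V = "g 1 (int k)"
  have gH: "?V \<in> H" using g_in_H q_ge_3 by auto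
  note H = gH X_Y_in_H br_closed dp.subspace_scale[OF subspace_L]
  note br = brackets_below_diamond[of "int k", unfolded field]
  show ?thesis
  proof (rule that[of "a * (\<rho> + \<sigma>)" "monom (g (q - 2) (int k + 2)) (k + 2)"])
    show "lbr (lbr v (monom X 1)) (monom X 1) = 0" "lbr (lbr v (monom Y 1)) (monom Y 1) = 0"
      unfolding a using H br(1,2) by (simp_all add: loop_bracket_monom br_scale_left del: One_nat_def)
    show "lbr (lbr v (monom X 1)) (monom Y 1) =
        lsc (- (a * (\<rho> + \<sigma>)) * (\<rho> - of_nat m * \<sigma>)) (monom (g (q - 2) (int k + 2)) (k + 2))"
      unfolding a loop_scale_monom using H br(3)
      by (simp add: loop_bracket_monom br_scale_left mult.assoc Suc_eq_plus1 del: One_nat_def)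
    show "lbr (lbr v (monom Y 1)) (monom X 1) =
        lsc (a * (\<rho> + \<sigma>) * (2 * \<rho> - of_nat m * \<sigma>)) (monom (g (q - 2) (int k + 2)) (k + 2))"
      unfolding a loop_scale_monom using H br(4)
      by (simp add: loop_bracket_monom br_scale_left mult.assoc Suc_eq_plus1 del: One_nat_def)
  qed
qed

lemma rho_nonzero: "\<rho> \<noteq> 0"
  using root_nonzero[of 1 0] by simp

lemma has_finite_type_loop:
  "has_finite_type lsc lbr (loop_component N) (monom X 1) (monom Y 1) (1 + (m + 1) * (q - 1))
     (- 1 + of_nat m * (\<sigma> / \<rho>))"
  unfolding has_finite_type_def
proof (intro conjI ballI impI)
  let ?i = "1 + (m + 1) * (q - 1)"
  have i: "?i - 1 = (m + 1) * (q - 1)" by simp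
  show "?i > 1" using q_ge_3 by simp
  show "?i \<in> diamond_degrees lsc (loop_component N)"
    unfolding diamond_degrees_loop by (simp add: cong_altdef_nat)
  have "\<not> [int ((m + 1) * (q - 1)) = 1] (mod (int q - 1))"
  proof
    assume "[int ((m + 1) * (q - 1)) = 1] (mod (int q - 1))"
    then have "int q - 1 dvd int (m + 1) * (int q - 1) - 1"
      using q_ge_3 unfolding cong_iff_dvd_diff of_nat_mult by (simp add: of_nat_diff)
    then have "int q - 1 dvd 1" by (metis dvd_diff_right_iff dvd_triv_right)
    then show False using q_ge_3 by simp
  qed
  then show "loop.dim (loop_component N (?i - 1)) = 1"
    unfolding i using q_ge_3 by (subst dim_loop_component) auto
  fix v assume "v \<in> loop_component N (?i - 1)"
  then have v: "v \<in> loop_component N ((m + 1) * (q - 1))" by simp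
  obtain E c where
    br: "lbr (lbr v (monom X 1)) (monom X 1) = 0" "lbr (lbr v (monom Y 1)) (monom Y 1) = 0"
    "lbr (lbr v (monom X 1)) (monom Y 1) = lsc (- c * (\<rho> - of_nat m * \<sigma>)) E"
    "lbr (lbr v (monom Y 1)) (monom X 1) = lsc (c * (2 * \<rho> - of_nat m * \<sigma>)) E"
    by (rule loop_brackets_below_diamond[OF v])
  show "lbr (lbr v (monom X 1)) (monom X 1) = 0" "lbr (lbr v (monom Y 1)) (monom Y 1) = 0"
    by (rule br)+
  have "(1 - (- 1 + of_nat m * (\<sigma> / \<rho>))) * (- c * (\<rho> - of_nat m * \<sigma>)) =
      (- 1 + of_nat m * (\<sigma> / \<rho>)) * (c * (2 * \<rho> - of_nat m * \<sigma>))"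
    using rho_nonzero by (simp add: field_simps)
  then show "lsc (1 - (- 1 + of_nat m * (\<sigma> / \<rho>))) (lbr (lbr v (monom X 1)) (monom Y 1)) =
      lsc (- 1 + of_nat m * (\<sigma> / \<rho>)) (lbr (lbr v (monom Y 1)) (monom X 1))"
    unfolding br loop.scale_scale by (simp only:)
qed

lemma type_generators_loop:
  "type_generators lsc lbr (loop_component N) q (monom X 1) (monom Y 1)"
  unfolding type_generators_def
proof (intro conjI impI ballI)
  interpret monom: Vector_Spaces.linear dp_scale lsc "\<lambda>u. monom u 1"
    by (rule linear_monom)
  show "loop.span {monom X 1, monom Y 1} = loop_component N 1"
    using monom.span_image[of "{X, Y}"] by (simp add: loop_component_eq component_1)
  show "lbr u (monom Y 1) = 0" if q: "q > 3" and u: "u \<in> loop_component N 2" for u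
  proof -
    have "[2 = 1 - int (q - 2)] (mod (int q - 1))"
      using q_ge_3 by (simp add: cong_iff_dvd_diff of_nat_diff)
    then have "comp_basis 2 = {g (q - 2) 2}" using q by (intro comp_basis_single) auto
    then obtain a where "u = monom (dp_scale a (g (q - 2) 2)) 2"
      using u by (auto simp: loop_component_eq component_def dp.span_singleton)
    moreover have "g (q - 2) 2 \<in> H" using g_in_H q_ge_3 by auto
    ultimately show ?thesis
      using q X_Y_in_H dp.subspace_scale[OF subspace_L] hbr_g_top_eq_0[of "q - 2" 2 1]
      by (simp add: loop_bracket_monom br_scale_left del: One_nat_def)
  qed
  fix v assume "v \<in> loop_component N (q - 1)"
  then have v: "v \<in> loop_component N ((0 + 1) * (q - 1))" by simp
  obtain E c where
    br: "lbr (lbr v (monom X 1)) (monom X 1) = 0" "lbr (lbr v (monom Y 1)) (monom Y 1) = 0"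
    "lbr (lbr v (monom X 1)) (monom Y 1) = lsc (- c * (\<rho> - of_nat 0 * \<sigma>)) E"
    "lbr (lbr v (monom Y 1)) (monom X 1) = lsc (c * (2 * \<rho> - of_nat 0 * \<sigma>)) E"
    by (rule loop_brackets_below_diamond[OF v])
  show "lbr (lbr v (monom X 1)) (monom X 1) = 0" "lbr (lbr v (monom Y 1)) (monom Y 1) = 0"
    by (rule br)+
  show "lbr (lbr v (monom Y 1)) (monom X 1) = lsc (- 2) (lbr (lbr v (monom X 1)) (monom Y 1))"
    unfolding br by (simp add: mult.left_commute)
qed

lemma types_not_in_prime_subfield:
  "\<not> range (\<lambda>m::nat. - 1 + of_nat m * (\<sigma> / \<rho>)) \<subseteq> prime_subfield"
proof
  assume "range (\<lambda>m::nat. - 1 + of_nat m * (\<sigma> / \<rho>)) \<subseteq> prime_subfield"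
  then have "- 1 + of_nat 1 * (\<sigma> / \<rho>) \<in> prime_subfield" by blast
  then obtain c where "- 1 + \<sigma> / \<rho> = of_int c" by (auto simp: prime_subfield_def)
  then have *: "\<sigma> / \<rho> = of_int (c + 1)" by (simp add: algebra_simps)
  then have "of_int (c + 1) * \<rho> + of_int (- 1) * \<sigma> = 0" using rho_nonzero by (simp add: field_simps)
  then have "of_int (c + 1) = (0 :: 'a)" using root_nonzero by blast
  then show False using * sigma_nonzero rho_nonzero by simp
qed

lemma ham_index_eq: "ham_index q \<sigma> \<rho> = {(1 - int j, weight j s) | j s. j < q}"
proof -
  have "j \<le> q - 1 \<longleftrightarrow> j < q" for j using q_ge_3 by auto
  then show ?thesis unfolding ham_index_def prime_subfield_def weight_def by blast
qed

lemma ham_index_image: "(\<lambda>(r, \<alpha>). ham_e \<sigma> r \<alpha>) ` ham_index q \<sigma> \<rho> = g_basis"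
  by (auto simp: ham_index_eq g_basis_def g_def image_iff)

lemma graded_basis_ham_e:
  "graded_basis dp_scale H component (ham_index q \<sigma> \<rho>) (\<lambda>(r, \<alpha>). ham_e \<sigma> r \<alpha>)"
  unfolding graded_basis_def ham_index_image
proof (intro conjI ballI)
  show "inj_on (\<lambda>(r, \<alpha>). ham_e \<sigma> r \<alpha>) (ham_index q \<sigma> \<rho>)"
  proof (rule inj_onI)
    fix x y assume x: "x \<in> ham_index q \<sigma> \<rho>" and y: "y \<in> ham_index q \<sigma> \<rho>"
      and eq: "(case x of (r, \<alpha>) \<Rightarrow> ham_e \<sigma> r \<alpha>) = (case y of (r, \<alpha>) \<Rightarrow> ham_e \<sigma> r \<alpha>)"
    obtain j s where js: "x = (1 - int j, weight j s)"
      using x by (auto simp: ham_index_eq)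
    obtain l t where lt: "y = (1 - int l, weight l t)"
      using y by (auto simp: ham_index_eq)
    have "j = l" "[s = t] (mod int p)" using eq js lt g_eq_iff[of j s l t] by (auto simp: g_def)
    then show "x = y"
      using of_int_eq_iff_cong_CHAR[where 'a='a, of s t] char by (simp add: js lt weight_def)
  qed
  show "dp.independent g_basis" by (rule independent_g_basis)
  show "dp.span g_basis = H" by (rule span_g_basis)
  fix x assume "x \<in> ham_index q \<sigma> \<rho>"
  then have "(case x of (r, \<alpha>) \<Rightarrow> ham_e \<sigma> r \<alpha>) \<in> g_basis" using ham_index_image by blast
  then show "\<exists>k. (case x of (r, \<alpha>) \<Rightarrow> ham_e \<sigma> r \<alpha>) \<in> component k"
    using g_in_some_component by (fastforce simp: g_basis_def)
qed

lemma ham_e_in_component_iff: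
  assumes "2 - int q \<le> r" "r \<le> 1"
  shows "ham_e \<sigma> r (of_int r * \<rho> + of_int s * \<sigma>) \<in> component k \<longleftrightarrow>
    [k = r] (mod (int q - 1)) \<and> [k = s] (mod int p)"
proof -
  define j where "j = nat (1 - r)"
  have "1 - int j = r" "j < q" using assms by (auto simp: j_def)
  then show ?thesis using g_in_component_iff[of j s k] by (simp add: g_def weight_def)
qed

lemma X_eq: "X = ham_e \<sigma> 1 (\<rho> + \<sigma>)"
  by (simp add: g_def weight_def)

lemma Y_eq: "Y = ham_e \<sigma> (2 - int q) (2 * \<rho> + \<sigma>)"
  using q_ge_3 by (simp add: g_def weight_def of_nat_diff)

lemma generators_in_ham_index:
  "(1, \<rho> + \<sigma>) \<in> ham_index q \<sigma> \<rho>" "(2 - int q, 2 * \<rho> + \<sigma>) \<in> ham_index q \<sigma> \<rho>"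
proof -
  have "weight 0 1 = \<rho> + \<sigma>" "weight (q - 1) 1 = 2 * \<rho> + \<sigma>" "1 - int (q - 1) = 2 - int q"
    using q_ge_3 by (simp_all add: weight_def of_nat_diff)
  then have "(1, \<rho> + \<sigma>) = (1 - int 0, weight 0 1)"
    "(2 - int q, 2 * \<rho> + \<sigma>) = (1 - int (q - 1), weight (q - 1) 1)" by simp_all
  moreover have "0 < q" "q - 1 < q" using q_ge_3 by simp_all
  ultimately show "(1, \<rho> + \<sigma>) \<in> ham_index q \<sigma> \<rho>" "(2 - int q, 2 * \<rho> + \<sigma>) \<in> ham_index q \<sigma> \<rho>"
    unfolding ham_index_eq by blast+
qed

end

theorem theorem6p1:
  fixes \<sigma> \<rho> :: "'a::field"
    and p n q :: nat
    and H :: "'a dp set"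
    and br :: "'a dp \<Rightarrow> 'a dp \<Rightarrow> 'a dp"
    and X Y :: "'a dp"
  assumes "CHAR('a) = p" and "odd p"
    and "n > 0" and "q = p ^ n"
    and "\<sigma> \<noteq> 0" and "\<rho> ^ p - \<sigma> ^ (p - 1) * \<rho> - 1 = 0"
    and "H = dp_space 1 n" and "br = ham_bracket 1 n"
    and "X = ham_e \<sigma> 1 (\<rho> + \<sigma>)" and "Y = ham_e \<sigma> (2 - int q) (2 * \<rho> + \<sigma>)"
  shows
    "lie_generated dp_scale H br {X, Y} = H \<and>
     (\<exists>S. cyclic_lie_grading dp_scale H br ((q - 1) * p) S \<and> X \<in> S 1 \<and> Y \<in> S 1 \<and>
        (\<forall>S'. cyclic_lie_grading dp_scale H br ((q - 1) * p) S' \<and> X \<in> S' 1 \<and> Y \<in> S' 1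
           \<longrightarrow> S' = S) \<and>
        graded_basis dp_scale H S (ham_index q \<sigma> \<rho>) (\<lambda>(r, \<alpha>). ham_e \<sigma> r \<alpha>) \<and>
        (1, \<rho> + \<sigma>) \<in> ham_index q \<sigma> \<rho> \<and> (2 - int q, 2 * \<rho> + \<sigma>) \<in> ham_index q \<sigma> \<rho> \<and>
        (\<forall>r s k. 2 - int q \<le> r \<and> r \<le> 1 \<longrightarrow>
           (ham_e \<sigma> r (of_int r * \<rho> + of_int s * \<sigma>) \<in> S k \<longleftrightarrow>
              [k = r] (mod (int q - 1)) \<and> [k = s] (mod int p))) \<and>
        (let sc = loop_scale dp_scale; lbr = loop_bracket br;
             N = loop_algebra dp_scale H br S; V = loop_component N;
             XL = monom X 1; YL = monom Y 1
         in thin_lie_algebra sc N lbr V \<and>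
            second_diamond_degree sc V q \<and>
            diamond_degrees sc V = {i. i \<ge> 1 \<and> [i = 1] (mod (q - 1))} \<and>
            type_generators sc lbr V q XL YL \<and>
            (\<exists>a d. (\<forall>m. has_finite_type sc lbr V XL YL (1 + (m + 1) * (q - 1)) (a + of_nat m * d)) \<and>
                   \<not> (range (\<lambda>m::nat. a + of_nat m * d) \<subseteq> prime_subfield))))"
proof -
  interpret hamiltonian_roots \<sigma> \<rho> p n q
    using assms by unfold_locales auto
  have XY: "X = g 0 1" "Y = g (q - 1) 1" using assms X_eq Y_eq by simp_all
  have XY1: "X \<in> component 1" "Y \<in> component 1"
    unfolding XY component_1 by (simp_all add: dp.span_base)
  show ?thesis
    unfolding assms(7,8) H_def[symmetric] hbr_def[symmetric] M_def[symmetric] Let_def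
    using lie_generated_X_Y cyclic_lie_grading_component XY1 graded_basis_ham_e
      generators_in_ham_index thin_loop second_diamond_degree_loop
      diamond_degrees_loop type_generators_loop types_not_in_prime_subfield
    by (intro conjI exI[of _ component] allI impI exI[of _ "- 1"] exI[of _ "\<sigma> / \<rho>"])
      (simp_all add: XY cyclic_lie_grading_unique ham_e_in_component_iff has_finite_type_loop[simplified])
qed

end
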